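(* Let $d,N,b,T\ge 1$ be integers, let $L>0$ and $\sigma,\tau\ge 0$ be real numbers, and let $F(\theta)=\frac1N\sum_{i=1}^N f^i(\theta)$ on $\mathbb{R}^d$, where $f^i(\theta)=\mathbb{E}_{\xi^i\sim\mathcal{D}^i}[f^i(\theta;\xi^i)]$ and the distributions $\mathcal{D}^1,\dots,\mathcal{D}^N$ may differ. Assume: (1) $F$ is $L$-smooth: for all $\theta_1,\theta_2\in\mathbb{R}^d$, $\|\nabla F(\theta_1)-\nabla F(\theta_2)\|\le L\|\theta_1-\theta_2\|$ and $F(\theta_2)\le F(\theta_1)+\langle\nabla F(\theta_1),\theta_2-\theta_1\rangle+\frac L2\|\theta_2-\theta_1\|^2$. (2) For all $i\in[N]$ and $\theta\in\mathbb{R}^d$, $\mathbb{E}[\nabla f^i(\theta;\xi^i)]=\nabla f^i(\theta)$ and $\mathbb{E}\big[\|\nabla f^i(\theta;\xi^i)-\nabla f^i(\theta)\|^2\big]\le\sigma^2$. (3) For all $i\in[N]$ and $\theta\in\mathbb{R}^d$, $\|\nabla f^i(\theta)-\nabla F(\theta)\|^2\le\tau^2$. (4) $F^*:=\inf_{\theta\in\mathbb{R}^d}F(\theta)>-\infty$. Let $\{\theta_t\}_{t=0}^T$ be generated by the AdaBFL algorithm (described in the context) with step size $\eta\in\left(0,\frac{1}{8L}\right]$ and batch size $b$, with stochastic gradients $g_t^i=\frac1b\sum_{j=1}^b\nabla f^i(\theta_{t-1};\xi^i_{t-1,j})$. Define the aggregation error $$e_t=\theta_t-\Big(\theta_{t-1}-\eta\,\frac1N\sum_{i\in[N]}g_t^i\Big),\qquad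 t=1,\dots,T,$$ and suppose that $\|e_t\|\le K\eta^2$ for all $t=1,\dots,T$, where $K=\sqrt{\sigma+\tau}$. Then $$\frac1T\sum_{t=0}^{T-1}\mathbb{E}\big[\|\nabla F(\theta_t)\|^2\big]\le\frac{2\,(F(\theta_0)-F^* )}{\eta T}+\frac{7K^2\eta^2}{4}+2L\eta D,\qquad D=\frac{2\sigma^2}{bN}+\tau^2 .$$
   Context: Notation: $[N]=\{1,\dots,N\}$; $\|\cdot\|$ is the Euclidean norm; $\theta[k]$ is the $k$-th coordinate of $\theta\in\mathbb{R}^d$. The trimmed mean with parameter $\beta$ of a finite list of vectors is computed coordinatewise: in each coordinate the $\beta$ largest and $\beta$ smallest values are discarded and the remaining ones averaged. AdaBFL algorithm. Inputs: $N$ clients, of which $n$ (indexed by $[n]$) participate in aggregation; learning rate $\eta>0$; batch size $b$; aggregation weights $\beta_1,\beta_2,\beta_3$; parameters $\gamma,\kappa>0$; a non-negative monotone function $\lambda(t)$; a trimming parameter $\beta$; a number $m$ of synthetic models; weight-update constants $\rho_1,\rho_2,\delta_{\rm high},\delta_{\rm low},\beta_{1\_\min},\beta_{1\_{\rm base}},\beta_{2\_\max},\beta_{3\_\min}$. The initial model $\theta_0\in\mathbb{R}^d$ is deterministic. In each round $t=1,2,\dots,T$: (Local step) For each client $i$, draw $b$ i.i.d. samples $\xi^i_{t-1,1},\dots,\xi^i_{t-1,b}$ from $\mathcal{D}^i$, independently across clients and independently of all previous rounds. Set $g_t^i=\frac1b\sum_{j=1}^b\nabla f^i(\theta_{t-1};\xi^i_{t-1,j})$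 and $\theta_t^i=\theta_{t-1}-\eta g_t^i$, and send $\theta_t^i$ to the server. (Filtering) Let $\Lambda$ be the set of clients $i\in[n]$ such that, with $m_t^i=\frac{1}{n-1}\sum_{j\in[n],\,j\ne i}\theta_t^j$, one has $\|\theta_t^i-m_t^i\|\le\frac{\gamma e^{-\kappa\lambda(t)}}{2}\|m_t^i+\theta_t^i\|$. (Parameter clipping) Let $\widetilde\theta_t$ be the trimmed mean (parameter $\beta$) of $\{\theta_t^i\}_{i\in\Lambda}$, and let $p_t^1=\frac1d\|\widetilde\theta_t-\mathrm{mean}(\{\theta_t^i\}_{i\in\Lambda})\|$. (Derivative model) Let $\theta_t^{\max}[k]=\max_{i\in\Lambda}\theta_t^i[k]$, $\theta_t^{\min}[k]=\min_{i\in\Lambda}\theta_t^i[k]$, $S_t^i=\min\{\|\theta_t^i-\theta_t^{\max}\|,\|\theta_t^i-\theta_t^{\min}\|\}$ and $i_*\in\arg\max_{i\in\Lambda}S_t^i$. Let $\overline\theta_t$ be the trimmed mean of the models $\{\theta_t^i\}_{i\in\Lambda}$ together with $m$ copies of $\theta_t^{i_*}$, and let $p_t^2=\big\|\frac{1}{|\Lambda|}\sum_{i\in\Lambda}(\theta_t^i-\overline\theta_t)\big\|$. (Weight update) If $p_t^1\ge\rho_1$: $\beta_2\gets\min(\beta_2+\delta_{\rm high},\beta_{2\_\max})$ and $\beta_1\gets\max(\beta_1-\delta_{\rm high},\beta_{1\_\min})$. Else if $p_t^2<\rho_2$: $\beta_3\gets\max(\beta_3-\delta_{\rm low},\beta_{3\_\min})$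 and $\beta_2\gets\min(\beta_2+\delta_{\rm high},\beta_{2\_\max})$. Else: $\beta_1\gets\beta_{1\_{\rm base}}+\kappa(1-p_t^1)$. Then divide $\beta_1,\beta_2,\beta_3$ by their sum so that $\beta_1+\beta_2+\beta_3=1$. (Aggregation) $\theta_t=\beta_1\,\mathrm{mean}(\{\theta_t^i\}_{i\in\Lambda})+\beta_2\,\widetilde\theta_t+\beta_3\,\overline\theta_t$. It is assumed that every step is well defined (e.g. $|\Lambda|>2\beta$). The bound $\|e_t\|\le K\eta^2$ is assumed to hold surely (or almost surely) for every round, and $\mathbb{E}$ is the expectation over all the sampling. *)

theory Defs
  imports "HOL-Probability.Probability"
begin

section \<open>Gradients and losses\<close>

definition grad :: "('v::real_inner \<Rightarrow> real) \<Rightarrow> 'v \<Rightarrow> 'v" where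
  "grad h x = (THE D. GDERIV h x :> D)"

definition local_loss ::
  "(nat \<Rightarrow> 'x measure) \<Rightarrow> (nat \<Rightarrow> real^'d \<Rightarrow> 'x \<Rightarrow> real) \<Rightarrow> nat \<Rightarrow> real^'d \<Rightarrow> real" where
  "local_loss D f i \<theta> = (LINT x|D i. f i \<theta> x)"

definition global_loss ::
  "(nat \<Rightarrow> 'x measure) \<Rightarrow> (nat \<Rightarrow> real^'d \<Rightarrow> 'x \<Rightarrow> real) \<Rightarrow> nat \<Rightarrow> real^'d \<Rightarrow> real" where
  "global_loss D f N \<theta> = (1 / real N) * (\<Sum>i\<in>{1..N}. local_loss D f i \<theta>)"

definition sample_grad :: "(nat \<Rightarrow> real^'d \<Rightarrow> 'x \<Rightarrow> real) \<Rightarrow> nat \<Rightarrow> real^'d \<Rightarrow> 'x \<Rightarrow> real^'d" where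
  "sample_grad f i \<theta> x = grad (\<lambda>\<theta>'. f i \<theta>' x) \<theta>"

text \<open>
  The sample \<open>\<xi> s i j\<close> is the \<open>j\<close>-th one drawn by client \<open>i\<close> at the model of index \<open>s\<close>; it is
  therefore used in round \<open>s + 1\<close>.
\<close>

definition batch_grad ::
  "(nat \<Rightarrow> real^'d \<Rightarrow> 'x \<Rightarrow> real) \<Rightarrow> nat \<Rightarrow> (nat \<Rightarrow> nat \<Rightarrow> nat \<Rightarrow> 'x) \<Rightarrow> (nat \<Rightarrow> real^'d)
     \<Rightarrow> nat \<Rightarrow> nat \<Rightarrow> real^'d" where
  "batch_grad f b \<xi> \<theta> t i =
     (1 / real b) *\<^sub>R (\<Sum>j\<in>{1..b}. sample_grad f i (\<theta> (t - 1)) (\<xi> (t - 1) i j))"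

section \<open>One round of AdaBFL\<close>

record adabfl_params =
  participants :: nat                      \<comment> \<open>\<open>n\<close>\<close>
  init_weights :: "real \<times> real \<times> real"     \<comment> \<open>initial \<open>(\<beta>\<^sub>1, \<beta>\<^sub>2, \<beta>\<^sub>3)\<close>\<close>
  gam :: real
  kap :: real
  lam :: "nat \<Rightarrow> real"
  trim :: nat                              \<comment> \<open>the trimming parameter \<open>\<beta>\<close>\<close>
  synth :: nat                             \<comment> \<open>the number \<open>m\<close> of synthetic models\<close>
  rho1 :: real
  rho2 :: real
  delta_high :: real
  delta_low :: real
  beta1_min :: real
  beta1_base :: real
  beta2_max :: real
  beta3_min :: real

definition family_mean :: "nat set \<Rightarrow> (nat \<Rightarrow> real^'d) \<Rightarrow> real^'d" where
  "family_mean A \<phi> = (1 / real (card A)) *\<^sub>R (\<Sum>i\<in>A. \<phi> i)"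

definition trimmed_mean :: "nat \<Rightarrow> (real^'d) list \<Rightarrow> real^'d" where
  "trimmed_mean \<beta> vs =
     (\<chi> k. let ys = sort (map (\<lambda>v. v $ k) vs);
               zs = take (length ys - 2 * \<beta>) (drop \<beta> ys)
           in sum_list zs / real (length zs))"

definition model_list :: "nat set \<Rightarrow> (nat \<Rightarrow> real^'d) \<Rightarrow> (real^'d) list" where
  "model_list A \<phi> = map \<phi> (sorted_list_of_set A)"

definition loo_mean :: "nat \<Rightarrow> (nat \<Rightarrow> real^'d) \<Rightarrow> nat \<Rightarrow> real^'d" where
  "loo_mean n \<phi> i = (1 / (real n - 1)) *\<^sub>R (\<Sum>j\<in>{1..n} - {i}. \<phi> j)"

definition filtered :: "adabfl_params \<Rightarrow> nat \<Rightarrow> (nat \<Rightarrow> real^'d) \<Rightarrow> nat set" where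
  "filtered P t \<phi> =
     {i \<in> {1..participants P}.
        norm (\<phi> i - loo_mean (participants P) \<phi> i)
          \<le> gam P * exp (- kap P * lam P t) / 2 * norm (loo_mean (participants P) \<phi> i + \<phi> i)}"

definition coord_max :: "nat set \<Rightarrow> (nat \<Rightarrow> real^'d) \<Rightarrow> real^'d" where
  "coord_max A \<phi> = (\<chi> k. Max ((\<lambda>i. \<phi> i $ k) ` A))"

definition coord_min :: "nat set \<Rightarrow> (nat \<Rightarrow> real^'d) \<Rightarrow> real^'d" where
  "coord_min A \<phi> = (\<chi> k. Min ((\<lambda>i. \<phi> i $ k) ` A))"

definition extremal_score :: "nat set \<Rightarrow> (nat \<Rightarrow> real^'d) \<Rightarrow> nat \<Rightarrow> real" where
  "extremal_score A \<phi> i = min (norm (\<phi> i - coord_max A \<phi>)) (norm (\<phi> i - coord_min A \<phi>))"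

definition clipped_model :: "adabfl_params \<Rightarrow> nat set \<Rightarrow> (nat \<Rightarrow> real^'d) \<Rightarrow> real^'d" where
  "clipped_model P A \<phi> = trimmed_mean (trim P) (model_list A \<phi>)"

definition derivative_model ::
  "adabfl_params \<Rightarrow> nat set \<Rightarrow> (nat \<Rightarrow> real^'d) \<Rightarrow> nat \<Rightarrow> real^'d" where
  "derivative_model P A \<phi> s = trimmed_mean (trim P) (model_list A \<phi> @ replicate (synth P) (\<phi> s))"

definition clip_dev :: "adabfl_params \<Rightarrow> nat set \<Rightarrow> (nat \<Rightarrow> real^'d) \<Rightarrow> real" where
  "clip_dev P A \<phi> = (1 / real CARD('d)) * norm (clipped_model P A \<phi> - family_mean A \<phi>)"

definition derivative_dev ::
  "adabfl_params \<Rightarrow> nat set \<Rightarrow> (nat \<Rightarrow> real^'d) \<Rightarrow> nat \<Rightarrow> real" where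
  "derivative_dev P A \<phi> s =
     norm ((1 / real (card A)) *\<^sub>R (\<Sum>i\<in>A. \<phi> i - derivative_model P A \<phi> s))"

definition raw_weights ::
  "adabfl_params \<Rightarrow> real \<Rightarrow> real \<Rightarrow> real \<times> real \<times> real \<Rightarrow> real \<times> real \<times> real" where
  "raw_weights P p1 p2 = (\<lambda>(\<beta>1, \<beta>2, \<beta>3).
     if p1 \<ge> rho1 P
     then (max (\<beta>1 - delta_high P) (beta1_min P), min (\<beta>2 + delta_high P) (beta2_max P), \<beta>3)
     else if p2 < rho2 P
     then (\<beta>1, min (\<beta>2 + delta_high P) (beta2_max P), max (\<beta>3 - delta_low P) (beta3_min P))
     else (beta1_base P + kap P * (1 - p1), \<beta>2, \<beta>3))"

definition weight_sum :: "real \<times> real \<times> real \<Rightarrow> real" where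
  "weight_sum = (\<lambda>(\<beta>1, \<beta>2, \<beta>3). \<beta>1 + \<beta>2 + \<beta>3)"

definition normalized_weights :: "real \<times> real \<times> real \<Rightarrow> real \<times> real \<times> real" where
  "normalized_weights v = (1 / weight_sum v) *\<^sub>R v"

definition aggregate ::
  "adabfl_params \<Rightarrow> nat set \<Rightarrow> (nat \<Rightarrow> real^'d) \<Rightarrow> nat \<Rightarrow> real \<times> real \<times> real \<Rightarrow> real^'d" where
  "aggregate P A \<phi> s = (\<lambda>(\<beta>1, \<beta>2, \<beta>3).
     \<beta>1 *\<^sub>R family_mean A \<phi> + \<beta>2 *\<^sub>R clipped_model P A \<phi> + \<beta>3 *\<^sub>R derivative_model P A \<phi> s)"

text \<open>
  \<open>adabfl_step P t \<phi> s w w' \<theta>'\<close>: round \<open>t\<close>, run on the received models \<open>\<phi>\<close> with incoming weights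
  \<open>w\<close>, is well defined and produces the weights \<open>w'\<close> and the model \<open>\<theta>'\<close>, when \<open>s\<close> is the client
  chosen among the maximisers of the extremal score. The conditions on the cardinality and on the
  sum of the weights say that no trimmed mean is taken over an empty list and that the
  normalisation does not divide by zero.
\<close>

definition adabfl_step ::
  "adabfl_params \<Rightarrow> nat \<Rightarrow> (nat \<Rightarrow> real^'d) \<Rightarrow> nat \<Rightarrow> real \<times> real \<times> real \<Rightarrow> real \<times> real \<times> real
     \<Rightarrow> real^'d \<Rightarrow> bool" where
  "adabfl_step P t \<phi> s w w' \<theta>' \<longleftrightarrow>
     (let A = filtered P t \<phi>;
          v = raw_weights P (clip_dev P A \<phi>) (derivative_dev P A \<phi> s) w
      in card A > 2 * trim P
         \<and> is_arg_max (extremal_score A \<phi>) (\<lambda>i. i \<in> A) s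
         \<and> weight_sum v \<noteq> 0
         \<and> w' = normalized_weights v
         \<and> \<theta>' = aggregate P A \<phi> s w')"

section \<open>Trajectories\<close>

text \<open>A trajectory for one fixed outcome of the sampling; \<open>s t\<close> is the choice of \<open>i\<^sub>*\<close> in round \<open>t\<close>.\<close>

definition adabfl_run ::
  "adabfl_params \<Rightarrow> (nat \<Rightarrow> real^'d \<Rightarrow> 'x \<Rightarrow> real) \<Rightarrow> nat \<Rightarrow> real \<Rightarrow> nat \<Rightarrow> real^'d
     \<Rightarrow> (nat \<Rightarrow> nat \<Rightarrow> nat \<Rightarrow> 'x) \<Rightarrow> (nat \<Rightarrow> nat) \<Rightarrow> (nat \<Rightarrow> real \<times> real \<times> real)
     \<Rightarrow> (nat \<Rightarrow> real^'d) \<Rightarrow> bool" where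
  "adabfl_run P f b \<eta> T \<theta>\<^sub>0 \<xi> s w \<theta> \<longleftrightarrow>
     \<theta> 0 = \<theta>\<^sub>0 \<and> w 0 = init_weights P \<and>
     (\<forall>t\<in>{1..T}. adabfl_step P t (\<lambda>i. \<theta> (t - 1) - \<eta> *\<^sub>R batch_grad f b \<xi> \<theta> t i)
                   (s t) (w (t - 1)) (w t) (\<theta> t))"

definition agg_error ::
  "(nat \<Rightarrow> real^'d \<Rightarrow> 'x \<Rightarrow> real) \<Rightarrow> nat \<Rightarrow> nat \<Rightarrow> real
     \<Rightarrow> (nat \<Rightarrow> nat \<Rightarrow> nat \<Rightarrow> 'x) \<Rightarrow> (nat \<Rightarrow> real^'d) \<Rightarrow> nat \<Rightarrow> real^'d" where
  "agg_error f N b \<eta> \<xi> \<theta> t =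
     \<theta> t - (\<theta> (t - 1) - \<eta> *\<^sub>R ((1 / real N) *\<^sub>R (\<Sum>i\<in>{1..N}. batch_grad f b \<xi> \<theta> t i)))"

text \<open>The \<open>\<sigma>\<close>-algebra generated by all samples drawn in rounds \<open>1, \<dots>, t\<close>.\<close>

definition sample_history ::
  "'w measure \<Rightarrow> (nat \<Rightarrow> 'x measure) \<Rightarrow> nat \<Rightarrow> nat \<Rightarrow> (nat \<Rightarrow> nat \<Rightarrow> nat \<Rightarrow> 'w \<Rightarrow> 'x)
     \<Rightarrow> nat \<Rightarrow> 'w measure" where
  "sample_history M D N b \<xi> t =
     sigma (space M) {\<xi> s i j -` S \<inter> space M | s i j S.
       s < t \<and> i \<in> {1..N} \<and> j \<in> {1..b} \<and> S \<in> sets (D i)}"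

end

(*
  The mean stochastic gradient is grad F(theta) + V with a noise V that is centred given the past,
  because the model of index t is a measurable function of the samples of the earlier rounds; its
  second moment is at most sigma^2/(bN) since the bN samples of a round are independent. Hence
  theta' = theta - eta (grad F(theta) + V) + e with |e| <= K eta^2, and smoothness together with
    <g, e> <= (3/8) eta |g|^2 + (2/(3 eta)) |e|^2,   |x + e|^2 <= 2 |x|^2 + 2 |e|^2,   L eta <= 1/8
  makes the expected loss decrease by (eta/2) E|grad F(theta)|^2, up to
  L eta^2 sigma^2/(bN) + (19/24) K^2 eta^3. Telescoping gives the claim with 19/12 <= 7/4.
*)
theory Submission
  imports Defs
begin

section \<open>Gradients\<close>

text \<open>Neither measurability nor any moment of \<open>\<theta>\<close> is among the hypotheses;
  both have to be derived from the recursion. Measurability: a round branches on the random filtered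
  set and on the chosen client, but only finitely many such pairs exist, and for a fixed pair every
  ingredient is measurable. Sorting, the delicate one, amounts to taking minima and maxima. Since
  sample gradients are evaluated at a random model, they must be measurable in model and sample
  jointly; this comes from difference quotients. Moments: the start is deterministic, and a
  square-integrable model stays so after a round, because the gradient of \<open>F\<close> grows at
  most linearly, the noise variance is bounded uniformly in the model and the error is bounded. Only
  then do the expectations in the descent inequality split. The noises of one round all contain the
  same random model, so independence of the samples does not make them independent. They are still
  uncorrelated: given the model and one sample, the noise of any other sample is centred.\<close>

lemma grad_eqI:
  assumes "GDERIV h x :> D"
  shows "grad h x = D"
  unfolding grad_def
proof (rule the_equality)
  fix D' assume "GDERIV h x :> D'"
  with assms have "(\<lambda>y. y \<bullet> D') = (\<lambda>y. y \<bullet> D)"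
    unfolding gderiv_def by (metis has_derivative_unique)
  then show "D' = D"
    by (metis vector_eq_rdot inner_commute)
qed (fact assms)

text \<open>\<open>grad\<close> is a definite description, so a representing vector has to be
  exhibited before it carries any information. In finite dimension the values of the derivative on
  the basis are its coordinates.\<close>

lemma GDERIV_grad:
  fixes h :: "'v::euclidean_space \<Rightarrow> real"
  assumes "h differentiable (at x)"
  shows "GDERIV h x :> grad h x"
proof -
  obtain h' where h': "(h has_derivative h') (at x)"
    using assms by (auto simp: differentiable_def)
  then interpret h': bounded_linear h' by (rule has_derivative_bounded_linear)
  have "h' v = v \<bullet> (\<Sum>e\<in>Basis. h' e *\<^sub>R e)" for v
  proof -
    have "h' v = h' (\<Sum>e\<in>Basis. (v \<bullet> e) *\<^sub>R e)" by (simp add: euclidean_representation)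
    then show ?thesis by (simp add: h'.sum h'.scaleR inner_sum_right mult.commute)
  qed
  then have "h' = (\<lambda>v. v \<bullet> (\<Sum>e\<in>Basis. h' e *\<^sub>R e))" by (rule ext)
  with h' have D: "GDERIV h x :> (\<Sum>e\<in>Basis. h' e *\<^sub>R e)"
    unfolding gderiv_def by metis
  then show ?thesis using grad_eqI[OF D] by simp
qed

lemma GDERIV_sum:
  "(\<And>i. i \<in> I \<Longrightarrow> GDERIV (f i) x :> g i) \<Longrightarrow> GDERIV (\<lambda>x. \<Sum>i\<in>I. f i x) x :> (\<Sum>i\<in>I. g i)"
  unfolding gderiv_def inner_sum_right by (rule has_derivative_sum)

text \<open>Makes a gradient component a limit along a sequence rather than a filter, the form in
  which measurability passes to the limit.\<close>

lemma grad_inner_LIMSEQ: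
  fixes h :: "'v::euclidean_space \<Rightarrow> real"
  assumes "h differentiable (at x)"
  shows "(\<lambda>n. (h (x + (1 / real (Suc n)) *\<^sub>R v) - h x) / (1 / real (Suc n))) \<longlonglongrightarrow> grad h x \<bullet> v"
proof -
  have "((\<lambda>t. h (x + t *\<^sub>R v)) has_derivative (\<lambda>t. (t *\<^sub>R v) \<bullet> grad h x)) (at 0)"
    by (rule has_derivative_compose[of "\<lambda>t. x + t *\<^sub>R v" "\<lambda>t. t *\<^sub>R v", simplified])
       (auto intro!: derivative_eq_intros simp: GDERIV_grad[OF assms, unfolded gderiv_def])
  then have "((\<lambda>t. h (x + t *\<^sub>R v)) has_real_derivative (grad h x \<bullet> v)) (at 0)"
    by (simp add: has_field_derivative_def inner_commute mult_commute_abs)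
  then have "((\<lambda>t. (h (x + t *\<^sub>R v) - h x) / t) \<longlongrightarrow> grad h x \<bullet> v) (at 0)"
    by (simp add: DERIV_def)
  \<comment> \<open>\<open>at 0\<close> excludes the point 0 itself; the increments
    \<open>1 / real (Suc n)\<close> are never zero.\<close>
  moreover have "filterlim (\<lambda>n. 1 / real (Suc n)) (at 0) sequentially"
    using lim_1_over_n[THEN LIMSEQ_Suc] by (auto simp: filterlim_at)
  ultimately show ?thesis
    by (rule filterlim_compose)
qed

text \<open>The first argument is approximated pointwise by simple functions.\<close>

lemma borel_measurable_caratheodory:
  fixes f :: "'v::euclidean_space \<Rightarrow> 'x \<Rightarrow> real"
  assumes cont: "\<And>x. x \<in> space N \<Longrightarrow> continuous_on UNIV (\<lambda>\<phi>. f \<phi> x)"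
    and meas: "\<And>\<phi>. f \<phi> \<in> borel_measurable N"
  shows "(\<lambda>p. f (fst p) (snd p)) \<in> borel_measurable (borel \<Otimes>\<^sub>M N)"
proof -
  have "(\<lambda>\<phi>::'v. \<phi>) \<in> borel_measurable borel" by simp
  from borel_measurable_implies_sequence_metric[OF this, of 0]
  obtain q :: "nat \<Rightarrow> 'v \<Rightarrow> 'v" where q: "\<And>n. simple_function borel (q n)" "\<And>\<phi>. (\<lambda>n. q n \<phi>) \<longlonglongrightarrow> \<phi>"
    by auto
  show ?thesis
  proof (rule borel_measurable_LIMSEQ_real)
    fix p assume p: "p \<in> space (borel \<Otimes>\<^sub>M N :: ('v \<times> 'x) measure)"
    then have "isCont (\<lambda>\<phi>. f \<phi> (snd p)) (fst p)"
      using cont[of "snd p"] by (auto simp: space_pair_measure continuous_on_eq_continuous_at)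
    then show "(\<lambda>n. f (q n (fst p)) (snd p)) \<longlonglongrightarrow> f (fst p) (snd p)"
      using q(2) by (rule isCont_tendsto_compose)
  next
    fix n
    \<comment> \<open>The range of \<open>q n\<close> is finite, so the composite is patched
      together from finitely many measurable sections \<open>f \<phi>\<close>.\<close>
    have "q n \<in> borel \<rightarrow>\<^sub>M count_space (range (q n))"
      using q(1)[of n]
      by (auto simp: measurable_count_space_eq2 simple_function_def)
    then have "(\<lambda>p. q n (fst p)) \<in> (borel \<Otimes>\<^sub>M N) \<rightarrow>\<^sub>M count_space (range (q n))"
      by (rule measurable_compose[OF measurable_fst])
    moreover have "countable (range (q n))"
      using q(1)[of n] by (intro countable_finite) (simp add: simple_function_def)
    ultimately show "(\<lambda>p. f (q n (fst p)) (snd p)) \<in> borel_measurable (borel \<Otimes>\<^sub>M N)"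
      by (rule measurable_compose_countable'[rotated])
         (auto intro: measurable_compose[OF measurable_snd meas])
  qed
qed

text \<open>Measurability of the gradient in the sample alone would not suffice, as the model is
  random too. Differentiability makes \<open>f\<close> continuous in its first argument, hence
  jointly measurable; so are its difference quotients, and the gradient is their limit.\<close>

lemma borel_measurable_grad_joint:
  fixes f :: "'v::euclidean_space \<Rightarrow> 'x \<Rightarrow> real"
  assumes diff: "\<And>\<phi> x. x \<in> space N \<Longrightarrow> (\<lambda>\<phi>'. f \<phi>' x) differentiable (at \<phi>)"
    and meas: "\<And>\<phi>. f \<phi> \<in> borel_measurable N"
  shows "(\<lambda>p. grad (\<lambda>\<phi>'. f \<phi>' (snd p)) (fst p)) \<in> borel_measurable (borel \<Otimes>\<^sub>M N)"
proof -
  have "continuous_on UNIV (\<lambda>\<phi>. f \<phi> x)" if "x \<in> space N" for x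
    using diff[OF that] by (auto simp: continuous_on_eq_continuous_at intro!: differentiable_imp_continuous_within)
  from borel_measurable_caratheodory[of N f, OF this meas]
  have joint: "(\<lambda>p. f (fst p) (snd p)) \<in> borel_measurable (borel \<Otimes>\<^sub>M N)" .
  have shift: "(\<lambda>p. f (fst p + c) (snd p)) \<in> borel_measurable (borel \<Otimes>\<^sub>M N)" for c
  proof -
    have "(\<lambda>p. (fst p + c, snd p)) \<in> (borel \<Otimes>\<^sub>M N) \<rightarrow>\<^sub>M (borel \<Otimes>\<^sub>M N)" by measurable
    from measurable_compose[OF this joint] show ?thesis by simp
  qed
  show ?thesis
  proof (subst borel_measurable_euclidean_space, rule ballI, rule borel_measurable_LIMSEQ_real)
    fix e :: 'v and p assume p: "p \<in> space (borel \<Otimes>\<^sub>M N :: ('v \<times> 'x) measure)"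
    then have "(\<lambda>\<phi>'. f \<phi>' (snd p)) differentiable (at (fst p))"
      by (intro diff) (simp add: space_pair_measure mem_Times_iff)
    from grad_inner_LIMSEQ[OF this]
    show "(\<lambda>n. (f (fst p + (1 / real (Suc n)) *\<^sub>R e) (snd p) - f (fst p) (snd p)) / (1 / real (Suc n)))
        \<longlonglongrightarrow> grad (\<lambda>\<phi>'. f \<phi>' (snd p)) (fst p) \<bullet> e" .
  next
    fix e :: 'v and n
    show "(\<lambda>p. (f (fst p + (1 / real (Suc n)) *\<^sub>R e) (snd p) - f (fst p) (snd p)) / (1 / real (Suc n)))
        \<in> borel_measurable (borel \<Otimes>\<^sub>M N)"
      using shift[measurable] joint[measurable] by measurable
  qed
qed

section \<open>Measurability of an AdaBFL round\<close>

text \<open>Replaces the case distinction in insertion by a compare-and-exchange, so that each entry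
  of the result is one fixed formula in the inputs whatever their order.\<close>

lemma insort_le_Cons: "sorted (y # ys) \<Longrightarrow> insort x (y # ys) = min x y # insort (max x y) ys"
  for x y :: "'a::linorder"
  by (cases ys) (auto simp: min_def max_def)

text \<open>Measurability of a list-valued function is expressed by listing measurable entry functions, so
  that the length of the list does not depend on the argument.\<close>

lemma measurable_insort:
  fixes g :: "'w \<Rightarrow> real"
  assumes "g \<in> borel_measurable H" "set gs \<subseteq> borel_measurable H"
  shows "\<exists>hs. set hs \<subseteq> borel_measurable H \<and>
    (\<forall>\<omega>. sorted (map (\<lambda>h. h \<omega>) gs) \<longrightarrow> insort (g \<omega>) (map (\<lambda>h. h \<omega>) gs) = map (\<lambda>h. h \<omega>) hs)"
  using assms
proof (induction gs arbitrary: g)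
  case Nil
  then show ?case by (intro exI[of _ "[g]"]) auto
next
  case (Cons k gs)
  \<comment> \<open>What is handed on to the tail is this maximum, not \<open>g\<close>; hence the
    induction generalises over \<open>g\<close>.\<close>
  then have "(\<lambda>\<omega>. max (g \<omega>) (k \<omega>)) \<in> borel_measurable H" by auto
  from Cons.IH[OF this] Cons.prems obtain hs where hs: "set hs \<subseteq> borel_measurable H"
    "\<And>\<omega>. sorted (map (\<lambda>h. h \<omega>) gs) \<Longrightarrow>
      insort (max (g \<omega>) (k \<omega>)) (map (\<lambda>h. h \<omega>) gs) = map (\<lambda>h. h \<omega>) hs"
    by auto
  show ?case
    using hs Cons.prems
    by (intro exI[of _ "(\<lambda>\<omega>. min (g \<omega>) (k \<omega>)) # hs"])
       (auto simp: insort_le_Cons simp del: insort_key.simps(2))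
qed

lemma measurable_sort:
  fixes gs :: "('w \<Rightarrow> real) list"
  assumes "set gs \<subseteq> borel_measurable H"
  shows "\<exists>hs. set hs \<subseteq> borel_measurable H \<and> (\<forall>\<omega>. sort (map (\<lambda>g. g \<omega>) gs) = map (\<lambda>h. h \<omega>) hs)"
  using assms
proof (induction gs)
  case Nil
  then show ?case by (intro exI[of _ "[]"]) auto
next
  case (Cons g gs)
  then obtain hs where hs: "set hs \<subseteq> borel_measurable H"
    "\<And>\<omega>. sort (map (\<lambda>g. g \<omega>) gs) = map (\<lambda>h. h \<omega>) hs" by auto
  then have "sorted (map (\<lambda>h. h \<omega>) hs)" for \<omega> by (metis sorted_sort)
  with measurable_insort[of g H hs] Cons.prems hs show ?case by auto
qed

lemma borel_measurable_sum_list: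
  fixes gs :: "('w \<Rightarrow> real) list"
  shows "set gs \<subseteq> borel_measurable H \<Longrightarrow> (\<lambda>\<omega>. sum_list (map (\<lambda>g. g \<omega>) gs)) \<in> borel_measurable H"
  by (induction gs) auto

lemma borel_measurable_vec_iff:
  fixes g :: "'w \<Rightarrow> real^'d"
  shows "g \<in> borel_measurable H \<longleftrightarrow> (\<forall>k. (\<lambda>\<omega>. g \<omega> $ k) \<in> borel_measurable H)"
  by (subst borel_measurable_euclidean_space) (auto simp: Basis_vec_def inner_axis)

text \<open>Once sorted, the list is cut at positions that depend on its length only, so each
  coordinate is an average of fixed order statistics.\<close>

lemma borel_measurable_trimmed_mean:
  fixes gs :: "('w \<Rightarrow> real^'d) list"
  assumes "set gs \<subseteq> borel_measurable H"
  shows "(\<lambda>\<omega>. trimmed_mean \<beta> (map (\<lambda>g. g \<omega>) gs)) \<in> borel_measurable H"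
  unfolding borel_measurable_vec_iff
proof
  fix k
  have "set (map (\<lambda>g \<omega>. g \<omega> $ k) gs) \<subseteq> borel_measurable H"
    using assms by (auto simp: borel_measurable_vec_iff)
  from measurable_sort[OF this] obtain hs where hs: "set hs \<subseteq> borel_measurable H"
    "\<And>\<omega>. sort (map (\<lambda>g. g \<omega> $ k) gs) = map (\<lambda>h. h \<omega>) hs" by (auto simp: comp_def)
  \<comment> \<open>The two lengths do not depend on the argument, so evaluating at an arbitrary
    point such as \<open>undefined\<close> compares them.\<close>
  have len: "length gs = length hs"
    using arg_cong[OF hs(2)[of undefined], of length] by simp
  define zs where "zs = take (length hs - 2 * \<beta>) (drop \<beta> hs)"
  have "trimmed_mean \<beta> (map (\<lambda>g. g \<omega>) gs) $ k = sum_list (map (\<lambda>h. h \<omega>) zs) / real (length zs)" for \<omega>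
    using hs(2)[of \<omega>] len by (simp add: trimmed_mean_def zs_def Let_def comp_def take_map drop_map)
  moreover have "set zs \<subseteq> borel_measurable H"
    using hs(1) by (auto simp: zs_def dest!: in_set_takeD in_set_dropD)
  ultimately show "(\<lambda>\<omega>. trimmed_mean \<beta> (map (\<lambda>g. g \<omega>) gs) $ k) \<in> borel_measurable H"
    using borel_measurable_sum_list[of zs H] by simp
qed

section \<open>Ingredients of a round for a fixed, non-random set of retained clients\<close>

context
  fixes P :: adabfl_params and A :: "nat set" and H :: "'w measure" and \<phi> :: "nat \<Rightarrow> 'w \<Rightarrow> real^'d"
  assumes A: "finite A" and \<phi>: "\<And>i. i \<in> A \<Longrightarrow> \<phi> i \<in> borel_measurable H"
begin

lemma borel_measurable_family_mean: "(\<lambda>\<omega>. family_mean A (\<lambda>i. \<phi> i \<omega>)) \<in> borel_measurable H"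
  unfolding family_mean_def using \<phi> by (intro borel_measurable_scaleR borel_measurable_sum) auto

lemma borel_measurable_clipped_model: "(\<lambda>\<omega>. clipped_model P A (\<lambda>i. \<phi> i \<omega>)) \<in> borel_measurable H"
  using borel_measurable_trimmed_mean[of "map \<phi> (sorted_list_of_set A)" H "trim P"] A \<phi>
  by (auto simp: clipped_model_def model_list_def comp_def)

lemma borel_measurable_derivative_model:
  assumes "k \<in> A"
  shows "(\<lambda>\<omega>. derivative_model P A (\<lambda>i. \<phi> i \<omega>) k) \<in> borel_measurable H"
proof -
  let ?gs = "map \<phi> (sorted_list_of_set A) @ replicate (synth P) (\<phi> k)"
  have "set ?gs \<subseteq> borel_measurable H" using A \<phi> assms by auto
  from borel_measurable_trimmed_mean[OF this, of "trim P"] show ?thesis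
    by (simp add: derivative_model_def model_list_def comp_def)
qed

lemma borel_measurable_clip_dev: "(\<lambda>\<omega>. clip_dev P A (\<lambda>i. \<phi> i \<omega>)) \<in> borel_measurable H"
proof -
  note [measurable] = borel_measurable_clipped_model borel_measurable_family_mean
  show ?thesis unfolding clip_dev_def by measurable
qed

lemma borel_measurable_derivative_dev:
  assumes "k \<in> A"
  shows "(\<lambda>\<omega>. derivative_dev P A (\<lambda>i. \<phi> i \<omega>) k) \<in> borel_measurable H"
proof -
  note [measurable] = borel_measurable_derivative_model[OF assms] \<phi>
  show ?thesis unfolding derivative_dev_def by measurable
qed

end

text \<open>\<open>borel_prod\<close> identifies the Borel sets of triples with the product
  sigma-algebra, so the three weights can be treated one by one; the branch conditions are
  measurable predicates.\<close>

lemma borel_measurable_raw_weights: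
  assumes [measurable]: "p1 \<in> borel_measurable H" "p2 \<in> borel_measurable H" "w \<in> borel_measurable H"
  shows "(\<lambda>\<omega>. raw_weights P (p1 \<omega>) (p2 \<omega>) (w \<omega>)) \<in> borel_measurable H"
proof -
  have [measurable]: "w \<in> H \<rightarrow>\<^sub>M borel \<Otimes>\<^sub>M borel \<Otimes>\<^sub>M borel"
    using assms(3) by (simp add: borel_prod)
  have "(\<lambda>\<omega>. raw_weights P (p1 \<omega>) (p2 \<omega>) (w \<omega>)) \<in> H \<rightarrow>\<^sub>M borel \<Otimes>\<^sub>M borel \<Otimes>\<^sub>M borel"
    unfolding raw_weights_def split_beta by measurable
  then show ?thesis by (simp add: borel_prod)
qed

lemma borel_measurable_normalized_weights:
  assumes "v \<in> borel_measurable H"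
  shows "(\<lambda>\<omega>. normalized_weights (v \<omega>)) \<in> borel_measurable H"
proof -
  have [measurable]: "v \<in> H \<rightarrow>\<^sub>M borel \<Otimes>\<^sub>M borel \<Otimes>\<^sub>M borel"
    using assms by (simp add: borel_prod)
  have "(\<lambda>\<omega>. normalized_weights (v \<omega>)) \<in> H \<rightarrow>\<^sub>M borel \<Otimes>\<^sub>M borel \<Otimes>\<^sub>M borel"
    unfolding normalized_weights_def weight_sum_def split_beta scaleR_prod_def by measurable
  then show ?thesis by (simp add: borel_prod)
qed

lemma borel_measurable_aggregate:
  assumes "finite A" "\<And>i. i \<in> A \<Longrightarrow> \<phi> i \<in> borel_measurable H" "k \<in> A"
    and w: "w \<in> borel_measurable H"
  shows "(\<lambda>\<omega>. aggregate P A (\<lambda>i. \<phi> i \<omega>) k (w \<omega>)) \<in> borel_measurable H"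
proof -
  have [measurable]: "w \<in> H \<rightarrow>\<^sub>M borel \<Otimes>\<^sub>M borel \<Otimes>\<^sub>M borel"
    using w by (simp add: borel_prod)
  note [measurable] = borel_measurable_family_mean[of A \<phi> H, OF assms(1,2)]
    borel_measurable_clipped_model[of A \<phi> H, OF assms(1,2)]
    borel_measurable_derivative_model[of A \<phi> H, OF assms(1-3)]
  show ?thesis unfolding aggregate_def split_beta by measurable
qed

text \<open>There are finitely many possible values, and the event that the filter returns a given
  \<open>B\<close> is a finite conjunction of norm inequalities and their negations.\<close>

lemma measurable_filtered:
  assumes [measurable]: "\<And>i. i \<in> {1..participants P} \<Longrightarrow> \<phi> i \<in> borel_measurable H"
  shows "(\<lambda>\<omega>. filtered P t (\<lambda>i. \<phi> i \<omega>)) \<in> H \<rightarrow>\<^sub>M count_space (Pow {1..participants P})"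
proof -
  have loo: "(\<lambda>\<omega>. loo_mean (participants P) (\<lambda>i. \<phi> i \<omega>) i) \<in> borel_measurable H" for i
    unfolding loo_mean_def by (intro borel_measurable_scaleR borel_measurable_sum) auto
  define Q where "Q i \<omega> \<longleftrightarrow> norm (\<phi> i \<omega> - loo_mean (participants P) (\<lambda>i. \<phi> i \<omega>) i)
      \<le> gam P * exp (- kap P * lam P t) / 2 * norm (loo_mean (participants P) (\<lambda>i. \<phi> i \<omega>) i + \<phi> i \<omega>)"
    for i \<omega>
  have Q: "Measurable.pred H (Q i)" if "i \<in> {1..participants P}" for i
  proof -
    note [measurable] = loo[of i] assms[OF that]
    show ?thesis unfolding Q_def by measurable
  qed
  have eq: "(\<lambda>\<omega>. filtered P t (\<lambda>i. \<phi> i \<omega>)) -` {B} \<inter> space H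
      = {\<omega> \<in> space H. \<forall>i\<in>{1..participants P}. Q i \<omega> \<longleftrightarrow> i \<in> B}" if "B \<subseteq> {1..participants P}" for B
    using that unfolding filtered_def Q_def by (auto simp: set_eq_iff)
  have "Measurable.pred H (\<lambda>\<omega>. \<forall>i\<in>{1..participants P}. Q i \<omega> \<longleftrightarrow> i \<in> B)" for B
    using Q by (intro pred_intros_finite) (auto intro!: pred_intros_logic)
  then have "(\<lambda>\<omega>. filtered P t (\<lambda>i. \<phi> i \<omega>)) -` {B} \<inter> space H \<in> sets H" if "B \<subseteq> {1..participants P}" for B
    using eq[OF that] by (simp add: pred_def)
  moreover have "filtered P t (\<lambda>i. \<phi> i \<omega>) \<subseteq> {1..participants P}" for \<omega>
    by (auto simp: filtered_def)
  ultimately show ?thesis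
    by (subst measurable_count_space_eq2) auto
qed

text \<open>The outputs are given only through the relation \<open>adabfl_step\<close>. It
  determines them once the filtered set and the chosen client are known, so they agree with members
  of a finite family of measurable functions selected by a measurable index.\<close>

lemma adabfl_step_measurable:
  assumes \<phi>: "\<And>i. i \<in> {1..participants P} \<Longrightarrow> \<phi> i \<in> borel_measurable H"
    and s: "s \<in> H \<rightarrow>\<^sub>M count_space UNIV"
    and w: "w \<in> borel_measurable H"
    and step: "\<And>\<omega>. \<omega> \<in> space H \<Longrightarrow> adabfl_step P t (\<lambda>i. \<phi> i \<omega>) (s \<omega>) (w \<omega>) (w' \<omega>) (\<theta>' \<omega>)"
  shows "w' \<in> borel_measurable H" "\<theta>' \<in> borel_measurable H"
proof -
  define g where "g \<omega> = (filtered P t (\<lambda>i. \<phi> i \<omega>), s \<omega>)" for \<omega>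
  define I where "I = {(A, k). A \<subseteq> {1..participants P} \<and> k \<in> A}"
  have fin: "finite I"
    by (rule finite_subset[of _ "Pow {1..participants P} \<times> {1..participants P}"]) (auto simp: I_def)
  define W where "W p \<omega> = (case p of (A, k) \<Rightarrow> normalized_weights (raw_weights P
    (clip_dev P A (\<lambda>i. \<phi> i \<omega>)) (derivative_dev P A (\<lambda>i. \<phi> i \<omega>) k) (w \<omega>)))" for p \<omega>
  define \<Theta> where "\<Theta> p \<omega> = (case p of (A, k) \<Rightarrow> aggregate P A (\<lambda>i. \<phi> i \<omega>) k (W p \<omega>))" for p \<omega>
  \<comment> \<open>The arg max condition places the chosen client inside the filtered set;
    measurability of the derivative model was shown only for such a client.\<close>
  have gI: "g \<omega> \<in> I" if "\<omega> \<in> space H" for \<omega>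
    using step[OF that] unfolding adabfl_step_def Let_def g_def I_def is_arg_max_def
    by (auto simp: filtered_def)
  have g: "g \<in> H \<rightarrow>\<^sub>M count_space I"
  proof (subst measurable_count_space_eq2[OF fin], intro conjI ballI)
    fix p assume "p \<in> I"
    then obtain A k where p: "p = (A, k)" "A \<in> Pow {1..participants P}" by (auto simp: I_def)
    have "(\<lambda>\<omega>. filtered P t (\<lambda>i. \<phi> i \<omega>)) -` {A} \<inter> space H \<in> sets H"
      using p(2) by (intro measurable_sets[OF measurable_filtered[of P \<phi> H t, OF \<phi>]]) auto
    moreover have "s -` {k} \<inter> space H \<in> sets H"
      by (rule measurable_sets[OF s]) simp
    moreover have "g -` {p} \<inter> space H
      = ((\<lambda>\<omega>. filtered P t (\<lambda>i. \<phi> i \<omega>)) -` {A} \<inter> space H) \<inter> (s -` {k} \<inter> space H)"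
      unfolding g_def p(1) by auto
    ultimately show "g -` {p} \<inter> space H \<in> sets H" by (metis sets.Int)
  next
    show "g \<in> space H \<rightarrow> I" using gI by blast
  qed
  have W: "W p \<in> borel_measurable H" and \<Theta>: "\<Theta> p \<in> borel_measurable H" if "p \<in> I" for p
  proof -
    obtain A k where p: "p = (A, k)" by force
    then have A: "finite A" "\<And>i. i \<in> A \<Longrightarrow> \<phi> i \<in> borel_measurable H" "k \<in> A"
      using \<open>p \<in> I\<close> \<phi> by (auto simp: I_def intro: finite_subset)
    show W: "W p \<in> borel_measurable H"
      unfolding W_def p prod.case
      by (intro borel_measurable_normalized_weights borel_measurable_raw_weights w
          borel_measurable_clip_dev borel_measurable_derivative_dev A)
    show "\<Theta> p \<in> borel_measurable H"
      using W unfolding \<Theta>_def p prod.case by (intro borel_measurable_aggregate A)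
  qed
  have eq: "w' \<omega> = W (g \<omega>) \<omega>" "\<theta>' \<omega> = \<Theta> (g \<omega>) \<omega>" if "\<omega> \<in> space H" for \<omega>
    using step[OF that] unfolding adabfl_step_def Let_def g_def W_def \<Theta>_def by auto
  show "w' \<in> borel_measurable H"
    by (subst measurable_cong[OF eq(1)], assumption, rule measurable_compose_countable'[OF W g countable_finite[OF fin]])
  show "\<theta>' \<in> borel_measurable H"
    by (subst measurable_cong[OF eq(2)], assumption, rule measurable_compose_countable'[OF \<Theta> g countable_finite[OF fin]])
qed

section \<open>Independence of the fresh samples from the past\<close>

text \<open>Unlike \<open>sample_history\<close>, which grows by whole rounds, an arbitrary index
  set can be enlarged by a single sample of the current round.\<close>

definition gen_sigma :: "'w measure \<Rightarrow> ('i \<Rightarrow> 'x measure) \<Rightarrow> ('i \<Rightarrow> 'w \<Rightarrow> 'x) \<Rightarrow> 'i set \<Rightarrow> 'w measure" where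
  "gen_sigma M N X J = sigma (space M) {X i -` S \<inter> space M | i S. i \<in> J \<and> S \<in> sets (N i)}"

lemma space_gen_sigma [simp]: "space (gen_sigma M N X J) = space M"
  by (auto simp: gen_sigma_def intro!: space_measure_of)

lemma sets_gen_sigma:
  "sets (gen_sigma M N X J) = sigma_sets (space M) (\<Union>i\<in>J. {X i -` S \<inter> space M | S. S \<in> sets (N i)})"
proof -
  have "{X i -` S \<inter> space M | i S. i \<in> J \<and> S \<in> sets (N i)}
      = (\<Union>i\<in>J. {X i -` S \<inter> space M | S. S \<in> sets (N i)})" by auto
  then show ?thesis
    unfolding gen_sigma_def by (subst sets_measure_of) auto
qed

lemma measurable_gen_sigma:
  assumes "i \<in> J" "X i \<in> M \<rightarrow>\<^sub>M N i"
  shows "X i \<in> gen_sigma M N X J \<rightarrow>\<^sub>M N i"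
  using assms by (intro measurableI) (auto simp: sets_gen_sigma dest: measurable_space)

lemma measurable_gen_sigma_mono:
  assumes "f \<in> gen_sigma M N X J \<rightarrow>\<^sub>M S" "J \<subseteq> J'"
  shows "f \<in> gen_sigma M N X J' \<rightarrow>\<^sub>M S"
proof -
  have "sets (gen_sigma M N X J) \<subseteq> sets (gen_sigma M N X J')"
    unfolding sets_gen_sigma using assms(2) by (intro sigma_sets_mono') blast
  then show ?thesis
    using assms(1) by (auto simp: measurable_def)
qed

lemma measurable_gen_sigma_imp_measurable:
  assumes "f \<in> gen_sigma M N X J \<rightarrow>\<^sub>M S" "\<And>i. i \<in> J \<Longrightarrow> X i \<in> M \<rightarrow>\<^sub>M N i"
  shows "f \<in> M \<rightarrow>\<^sub>M S"
proof -
  have "sets (gen_sigma M N X J) \<subseteq> sets M"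
    unfolding sets_gen_sigma using assms(2) by (intro sets.sigma_sets_subset) (auto intro: measurable_sets)
  then show ?thesis
    using assms(1) by (auto simp: measurable_def)
qed

lemma sample_history_eq_gen_sigma:
  "sample_history M D N b \<xi> t
     = gen_sigma M (\<lambda>(t, i, j). D i) (\<lambda>(t, i, j). \<xi> t i j) ({..<t} \<times> {1..N} \<times> {1..b})"
  unfolding sample_history_def gen_sigma_def
  by (rule arg_cong[where f = "sigma (space M)"]) auto

text \<open>The library's \<open>indep_var\<close> requires both variables to take values in the same type.\<close>

definition (in prob_space) indep_pair ::
  "'s measure \<Rightarrow> ('a \<Rightarrow> 's) \<Rightarrow> 't measure \<Rightarrow> ('a \<Rightarrow> 't) \<Rightarrow> bool" where
  "indep_pair S U T Y \<longleftrightarrow> random_variable S U \<and> random_variable T Y \<and>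
     distr M S U \<Otimes>\<^sub>M distr M T Y = distr M (S \<Otimes>\<^sub>M T) (\<lambda>x. (U x, Y x))"

text \<open>Disjoint blocks of an independent family generate independent sigma-algebras. Applied to
  the blocks \<open>J\<close> and \<open>{c}\<close> this gives the product rule on rectangles,
  which determines the joint law.\<close>

lemma (in prob_space) indep_pair_gen_sigma:
  assumes indep: "indep_vars N X I" and J: "J \<subseteq> I" "c \<in> I - J"
    and U: "U \<in> gen_sigma M N X J \<rightarrow>\<^sub>M S"
  shows "indep_pair S U (N c) (X c)"
proof -
  define E where "E i = {X i -` A \<inter> space M | A. A \<in> sets (N i)}" for i
  define G where "G = case_bool J {c}"
  have rv: "random_variable (N i) (X i)" if "i \<in> I" for i
    using indep that by (auto simp: indep_vars_def)
  have "indep_sets E I"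
    using indep unfolding indep_vars_def2 E_def by auto
  then have "indep_sets E (\<Union>k\<in>UNIV. G k)"
    by (rule indep_sets_mono_index[rotated]) (use J in \<open>auto simp: G_def split: bool.splits\<close>)
  \<comment> \<open>Independence extends from generators to generated sigma-algebras only for
    generators closed under intersection.\<close>
  moreover have "Int_stable (E i)" for i
    unfolding Int_stable_def E_def
  proof safe
    fix A B assume "A \<in> sets (N i)" "B \<in> sets (N i)"
    then show "\<exists>C. X i -` A \<inter> space M \<inter> (X i -` B \<inter> space M) = X i -` C \<inter> space M \<and> C \<in> sets (N i)"
      by (intro exI[of _ "A \<inter> B"]) auto
  qed
  moreover have "disjoint_family_on G UNIV"
    using J by (auto simp: disjoint_family_on_def G_def split: bool.splits)
  ultimately have "indep_sets (\<lambda>k. sigma_sets (space M) (\<Union>i\<in>G k. E i)) UNIV"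
    by (intro indep_sets_collect_sigma) auto
  then have ind: "indep_set (sets (gen_sigma M N X J)) (sigma_sets (space M) (E c))"
    unfolding indep_set_def
    by (rule indep_sets_mono_sets) (auto simp: G_def E_def sets_gen_sigma split: bool.splits)
  have [measurable]: "random_variable S U" "random_variable (N c) (X c)"
    using rv J by (auto intro!: measurable_gen_sigma_imp_measurable[OF U])
  interpret U: prob_space "distr M S U" by (rule prob_space_distr) simp
  interpret Y: prob_space "distr M (N c) (X c)" by (rule prob_space_distr) simp
  have "distr M S U \<Otimes>\<^sub>M distr M (N c) (X c) = distr M (S \<Otimes>\<^sub>M N c) (\<lambda>x. (U x, X c x))"
  proof (rule pair_measure_eqI)
    fix A B assume "A \<in> sets (distr M S U)" "B \<in> sets (distr M (N c) (X c))"
    then have [measurable]: "A \<in> sets S" "B \<in> sets (N c)" by simp_all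
    have "U -` A \<inter> space M \<in> sets (gen_sigma M N X J)"
      using measurable_sets[OF U, of A] by simp
    moreover have "X c -` B \<inter> space M \<in> sigma_sets (space M) (E c)"
      unfolding E_def by (intro sigma_sets.Basic) auto
    ultimately have "prob ((U -` A \<inter> space M) \<inter> (X c -` B \<inter> space M))
        = prob (U -` A \<inter> space M) * prob (X c -` B \<inter> space M)"
      by (rule indep_setD[OF ind])
    moreover have "(\<lambda>x. (U x, X c x)) -` (A \<times> B) \<inter> space M = (U -` A \<inter> space M) \<inter> (X c -` B \<inter> space M)"
      by auto
    ultimately show "emeasure (distr M S U) A * emeasure (distr M (N c) (X c)) B
        = emeasure (distr M (S \<Otimes>\<^sub>M N c) (\<lambda>x. (U x, X c x))) (A \<times> B)"
      by (simp add: emeasure_distr emeasure_eq_measure ennreal_mult)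
  qed (unfold_locales, simp)
  then show ?thesis
    unfolding indep_pair_def by simp
qed

section \<open>Moments of the gradient noise\<close>

lemma integrable_inner_of_square_integrable:
  fixes f g :: "'w \<Rightarrow> 'v::euclidean_space"
  assumes [measurable]: "f \<in> borel_measurable M" "g \<in> borel_measurable M"
    and "integrable M (\<lambda>x. (norm (f x))\<^sup>2)" "integrable M (\<lambda>x. (norm (g x))\<^sup>2)"
  shows "integrable M (\<lambda>x. f x \<bullet> g x)"
proof (rule Bochner_Integration.integrable_bound)
  show "integrable M (\<lambda>x. (norm (f x))\<^sup>2 + (norm (g x))\<^sup>2)"
    using assms by simp
  have "\<bar>u \<bullet> v\<bar> \<le> (norm u)\<^sup>2 + (norm v)\<^sup>2" for u v :: 'v
    using Cauchy_Schwarz_ineq2[of u v] sum_squares_bound[of "norm u" "norm v"]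
      mult_nonneg_nonneg[of "norm u" "norm v"] by simp
  then show "AE x in M. norm (f x \<bullet> g x) \<le> norm ((norm (f x))\<^sup>2 + (norm (g x))\<^sup>2)"
    by (intro AE_I2) simp
qed simp

lemma norm_add_square_le: "(norm (u + v))\<^sup>2 \<le> 2 * (norm u)\<^sup>2 + 2 * (norm v)\<^sup>2"
  for u v :: "'v::real_inner"
proof -
  have "0 \<le> (norm (u - v))\<^sup>2" by simp
  then show ?thesis
    by (simp add: power2_norm_eq_inner inner_diff_left inner_diff_right inner_add_left inner_add_right
        inner_commute)
qed

lemma square_integrable_add:
  fixes f g :: "'w \<Rightarrow> 'v::euclidean_space"
  assumes [measurable]: "f \<in> borel_measurable M" "g \<in> borel_measurable M"
    and "integrable M (\<lambda>x. (norm (f x))\<^sup>2)" "integrable M (\<lambda>x. (norm (g x))\<^sup>2)"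
  shows "integrable M (\<lambda>x. (norm (f x + g x))\<^sup>2)"
proof (rule Bochner_Integration.integrable_bound)
  show "integrable M (\<lambda>x. 2 * (norm (f x))\<^sup>2 + 2 * (norm (g x))\<^sup>2)"
    using assms by simp
  show "AE x in M. norm ((norm (f x + g x))\<^sup>2) \<le> norm (2 * (norm (f x))\<^sup>2 + 2 * (norm (g x))\<^sup>2)"
    by (intro AE_I2) (simp add: norm_add_square_le)
qed simp

lemma square_integrable_scaleR:
  fixes f :: "'w \<Rightarrow> 'v::euclidean_space"
  shows "integrable M (\<lambda>x. (norm (f x))\<^sup>2) \<Longrightarrow> integrable M (\<lambda>x. (norm (c *\<^sub>R f x))\<^sup>2)"
  by (simp add: power_mult_distrib)

text \<open>Pythagoras in L^2; pairwise vanishing of the mixed integrals is enough, with no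
  independence.\<close>

lemma integral_norm_square_orthogonal_sum:
  fixes Z :: "'a \<Rightarrow> 'w \<Rightarrow> 'v::euclidean_space"
  assumes "finite A"
    and Z: "\<And>a. a \<in> A \<Longrightarrow> Z a \<in> borel_measurable M"
    and sq: "\<And>a. a \<in> A \<Longrightarrow> integrable M (\<lambda>\<omega>. (norm (Z a \<omega>))\<^sup>2)"
    and orth: "\<And>a c. a \<in> A \<Longrightarrow> c \<in> A \<Longrightarrow> a \<noteq> c \<Longrightarrow> (LINT \<omega>|M. Z a \<omega> \<bullet> Z c \<omega>) = 0"
  shows "integrable M (\<lambda>\<omega>. (norm (\<Sum>a\<in>A. Z a \<omega>))\<^sup>2)"
    and "(LINT \<omega>|M. (norm (\<Sum>a\<in>A. Z a \<omega>))\<^sup>2) = (\<Sum>a\<in>A. LINT \<omega>|M. (norm (Z a \<omega>))\<^sup>2)"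
proof -
  have int: "integrable M (\<lambda>\<omega>. Z a \<omega> \<bullet> Z c \<omega>)" if "a \<in> A" "c \<in> A" for a c
    using that by (intro integrable_inner_of_square_integrable Z sq)
  have eq: "(norm (\<Sum>a\<in>A. Z a \<omega>))\<^sup>2 = (\<Sum>a\<in>A. \<Sum>c\<in>A. Z a \<omega> \<bullet> Z c \<omega>)" for \<omega>
    by (simp add: power2_norm_eq_inner inner_sum_left inner_sum_right) (rule sum.swap)
  show "integrable M (\<lambda>\<omega>. (norm (\<Sum>a\<in>A. Z a \<omega>))\<^sup>2)"
    unfolding eq by (intro Bochner_Integration.integrable_sum int)
  have "(LINT \<omega>|M. (norm (\<Sum>a\<in>A. Z a \<omega>))\<^sup>2) = (\<Sum>a\<in>A. \<Sum>c\<in>A. LINT \<omega>|M. Z a \<omega> \<bullet> Z c \<omega>)"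
    unfolding eq by (subst Bochner_Integration.integral_sum, intro Bochner_Integration.integrable_sum int)
      (auto intro!: sum.cong Bochner_Integration.integral_sum int)
  also have "\<dots> = (\<Sum>a\<in>A. \<Sum>c\<in>A. if c = a then LINT \<omega>|M. (norm (Z a \<omega>))\<^sup>2 else 0)"
    by (intro sum.cong refl) (auto simp: power2_norm_eq_inner orth)
  also have "\<dots> = (\<Sum>a\<in>A. LINT \<omega>|M. (norm (Z a \<omega>))\<^sup>2)"
    using \<open>finite A\<close> by simp
  finally show "(LINT \<omega>|M. (norm (\<Sum>a\<in>A. Z a \<omega>))\<^sup>2) = (\<Sum>a\<in>A. LINT \<omega>|M. (norm (Z a \<omega>))\<^sup>2)" .
qed

context prob_space
begin

text \<open>The Tonelli version asks for no integrability and therefore can establish it for the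
  squared noise. The signed version that follows serves the inner products, whose integrability then
  comes from square-integrability of the factors.\<close>

lemma indep_pair_nn_integral_eq:
  assumes indep: "indep_pair S U T Y" and h[measurable]: "h \<in> borel_measurable (S \<Otimes>\<^sub>M T)"
  shows "(\<integral>\<^sup>+\<omega>. h (U \<omega>, Y \<omega>) \<partial>M) = (\<integral>\<^sup>+u. \<integral>\<^sup>+y. h (u, y) \<partial>distr M T Y \<partial>distr M S U)"
proof -
  have [measurable]: "random_variable S U" "random_variable T Y"
    and eq: "distr M S U \<Otimes>\<^sub>M distr M T Y = distr M (S \<Otimes>\<^sub>M T) (\<lambda>x. (U x, Y x))"
    using indep unfolding indep_pair_def by auto
  interpret Y: prob_space "distr M T Y" by (rule prob_space_distr) simp
  have "(\<integral>\<^sup>+\<omega>. h (U \<omega>, Y \<omega>) \<partial>M) = (\<integral>\<^sup>+p. h p \<partial>distr M (S \<Otimes>\<^sub>M T) (\<lambda>x. (U x, Y x)))"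
    by (subst nn_integral_distr) auto
  also have "\<dots> = (\<integral>\<^sup>+p. h p \<partial>(distr M S U \<Otimes>\<^sub>M distr M T Y))" by (simp only: eq)
  also have "\<dots> = (\<integral>\<^sup>+u. \<integral>\<^sup>+y. h (u, y) \<partial>distr M T Y \<partial>distr M S U)"
    by (rule Y.nn_integral_fst[symmetric]) measurable
  finally show ?thesis .
qed

lemma indep_pair_integral_eq:
  fixes h :: "'s \<times> 't \<Rightarrow> real"
  assumes indep: "indep_pair S U T Y" and h[measurable]: "h \<in> borel_measurable (S \<Otimes>\<^sub>M T)"
    and int: "integrable M (\<lambda>\<omega>. h (U \<omega>, Y \<omega>))"
  shows "(LINT \<omega>|M. h (U \<omega>, Y \<omega>)) = (LINT u|distr M S U. LINT y|distr M T Y. h (u, y))"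
proof -
  have [measurable]: "random_variable S U" "random_variable T Y"
    and eq: "distr M S U \<Otimes>\<^sub>M distr M T Y = distr M (S \<Otimes>\<^sub>M T) (\<lambda>x. (U x, Y x))"
    using indep unfolding indep_pair_def by auto
  interpret U: prob_space "distr M S U" by (rule prob_space_distr) simp
  interpret Y: prob_space "distr M T Y" by (rule prob_space_distr) simp
  interpret pair_sigma_finite "distr M S U" "distr M T Y" ..
  have "integrable (distr M S U \<Otimes>\<^sub>M distr M T Y) h"
    unfolding eq by (subst integrable_distr_eq) (auto simp: int)
  from integral_fst'[OF this] show ?thesis
    unfolding eq by (subst (asm) (3) integral_distr) auto
qed

text \<open>With the model frozen, the inner integral over the fresh sample is bounded by
  \<open>v\<close>. The bound is uniform in the model, so it survives averaging over the law of
  \<open>X\<close>.\<close>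

lemma noise_second_moment:
  fixes Z :: "'v::euclidean_space \<Rightarrow> 'x \<Rightarrow> 'v"
  assumes indep: "indep_pair borel X D Y" and law: "distr M D Y = D"
    and Z[measurable]: "(\<lambda>p. Z (fst p) (snd p)) \<in> borel_measurable (borel \<Otimes>\<^sub>M D)"
    and int: "\<And>\<phi>. integrable D (\<lambda>x. (norm (Z \<phi> x))\<^sup>2)"
    and var: "\<And>\<phi>. (LINT x|D. (norm (Z \<phi> x))\<^sup>2) \<le> v"
  shows "integrable M (\<lambda>\<omega>. (norm (Z (X \<omega>) (Y \<omega>)))\<^sup>2)"
    and "(LINT \<omega>|M. (norm (Z (X \<omega>) (Y \<omega>)))\<^sup>2) \<le> v"
proof -
  have [measurable]: "random_variable borel X" "random_variable D Y"
    using indep unfolding indep_pair_def by auto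
  have [measurable]: "(\<lambda>\<omega>. Z (X \<omega>) (Y \<omega>)) \<in> borel_measurable M"
    using measurable_compose[OF measurable_Pair[of X M borel Y D] Z] by simp
  interpret X: prob_space "distr M borel X" by (rule prob_space_distr) simp
  \<comment> \<open>Nonnegativity of \<open>v\<close> is what allows the final bound to be brought
    back from \<open>ennreal\<close> to the reals.\<close>
  have "0 \<le> (LINT x|D. (norm (Z undefined x))\<^sup>2)" by simp
  then have v: "0 \<le> v" using var[of undefined] by linarith
  have "(\<integral>\<^sup>+\<omega>. ennreal ((norm (Z (X \<omega>) (Y \<omega>)))\<^sup>2) \<partial>M)
      = (\<integral>\<^sup>+u. \<integral>\<^sup>+y. ennreal ((norm (Z u y))\<^sup>2) \<partial>D \<partial>distr M borel X)"
    using indep_pair_nn_integral_eq[OF indep, of "\<lambda>p. ennreal ((norm (Z (fst p) (snd p)))\<^sup>2)"]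
    by (simp add: law)
  also have "\<dots> \<le> (\<integral>\<^sup>+u. ennreal v \<partial>distr M borel X)"
    using var by (intro nn_integral_mono) (simp add: nn_integral_eq_integral int ennreal_leI)
  also have "\<dots> = ennreal v" using X.emeasure_space_1 by simp
  finally have bound: "(\<integral>\<^sup>+\<omega>. ennreal ((norm (Z (X \<omega>) (Y \<omega>)))\<^sup>2) \<partial>M) \<le> ennreal v" .
  then show "integrable M (\<lambda>\<omega>. (norm (Z (X \<omega>) (Y \<omega>)))\<^sup>2)"
    by (intro integrableI_nonneg) (auto simp: order_le_less_trans)
  then show "(LINT \<omega>|M. (norm (Z (X \<omega>) (Y \<omega>)))\<^sup>2) \<le> v"
    using bound v by (simp add: nn_integral_eq_integral)
qed

text \<open>\<open>X\<close> and \<open>U\<close> may depend on each other, so the fresh sample has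
  to be independent of the pair. With both frozen, the inner integral is \<open>U\<close> against
  the mean of \<open>Z\<close>, which is zero.\<close>

lemma noise_orthogonal:
  fixes Z :: "'v::euclidean_space \<Rightarrow> 'x \<Rightarrow> 'v"
  assumes indep: "indep_pair (borel \<Otimes>\<^sub>M borel) (\<lambda>\<omega>. (X \<omega>, U \<omega>)) D Y" and law: "distr M D Y = D"
    and Z[measurable]: "(\<lambda>p. Z (fst p) (snd p)) \<in> borel_measurable (borel \<Otimes>\<^sub>M D)"
    and int: "\<And>\<phi>. integrable D (Z \<phi>)" and mean: "\<And>\<phi>. (LINT x|D. Z \<phi> x) = 0"
    and U2: "integrable M (\<lambda>\<omega>. (norm (U \<omega>))\<^sup>2)"
    and Z2: "integrable M (\<lambda>\<omega>. (norm (Z (X \<omega>) (Y \<omega>)))\<^sup>2)"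
  shows "(LINT \<omega>|M. U \<omega> \<bullet> Z (X \<omega>) (Y \<omega>)) = 0"
proof -
  have XU: "random_variable (borel \<Otimes>\<^sub>M borel) (\<lambda>\<omega>. (X \<omega>, U \<omega>))" and [measurable]: "random_variable D Y"
    using indep unfolding indep_pair_def by auto
  have [measurable]: "random_variable borel X" "random_variable borel U"
    using measurable_compose[OF XU measurable_fst] measurable_compose[OF XU measurable_snd] by auto
  have [measurable]: "(\<lambda>\<omega>. Z (X \<omega>) (Y \<omega>)) \<in> borel_measurable M"
    using measurable_compose[OF measurable_Pair[of X M borel Y D] Z] by simp
  have "(\<lambda>p. (fst (fst p), snd p)) \<in> ((borel \<Otimes>\<^sub>M borel) \<Otimes>\<^sub>M D :: (('v \<times> 'v) \<times> 'x) measure) \<rightarrow>\<^sub>M borel \<Otimes>\<^sub>M D"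
    by measurable
  from measurable_compose[OF this Z]
  have [measurable]: "(\<lambda>p. Z (fst (fst p)) (snd p))
      \<in> borel_measurable ((borel \<Otimes>\<^sub>M borel) \<Otimes>\<^sub>M D :: (('v \<times> 'v) \<times> 'x) measure)" by simp
  have "integrable M (\<lambda>\<omega>. U \<omega> \<bullet> Z (X \<omega>) (Y \<omega>))"
    by (intro integrable_inner_of_square_integrable U2 Z2) measurable
  then have "(LINT \<omega>|M. U \<omega> \<bullet> Z (X \<omega>) (Y \<omega>))
      = (LINT u|distr M (borel \<Otimes>\<^sub>M borel) (\<lambda>\<omega>. (X \<omega>, U \<omega>)). LINT y|D. snd u \<bullet> Z (fst u) y)"
    using indep_pair_integral_eq[OF indep, of "\<lambda>p. snd (fst p) \<bullet> Z (fst (fst p)) (snd p)"]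
    by (simp add: law)
  also have "\<dots> = 0"
    by (simp add: integral_inner_right int mean)
  finally show ?thesis .
qed

end

context prob_space
begin

text \<open>Every inner product is removed by the same argument with a different past:
  \<open>J\<close> alone against \<open>U\<close>, and \<open>J\<close> enlarged by one sample of
  the batch for the mixed terms. The second moment therefore grows like the batch size and not like
  its square.\<close>

lemma minibatch_noise:
  fixes Z :: "'i \<Rightarrow> 'v::euclidean_space \<Rightarrow> 'x \<Rightarrow> 'v"
  assumes indep: "indep_vars N \<xi> I" and J: "J \<subseteq> I" and B: "B \<subseteq> I - J" "finite B"
    and law: "\<And>a. a \<in> B \<Longrightarrow> distr M (N a) (\<xi> a) = N a"
    and X: "X \<in> borel_measurable (gen_sigma M N \<xi> J)"
    and U: "U \<in> borel_measurable (gen_sigma M N \<xi> J)" "integrable M (\<lambda>\<omega>. (norm (U \<omega>))\<^sup>2)"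
    and Z: "\<And>a. a \<in> B \<Longrightarrow> (\<lambda>p. Z a (fst p) (snd p)) \<in> borel_measurable (borel \<Otimes>\<^sub>M N a)"
    and int: "\<And>a \<phi>. a \<in> B \<Longrightarrow> integrable (N a) (Z a \<phi>)"
    and mean: "\<And>a \<phi>. a \<in> B \<Longrightarrow> (LINT x|N a. Z a \<phi> x) = 0"
    and int2: "\<And>a \<phi>. a \<in> B \<Longrightarrow> integrable (N a) (\<lambda>x. (norm (Z a \<phi> x))\<^sup>2)"
    and var: "\<And>a \<phi>. a \<in> B \<Longrightarrow> (LINT x|N a. (norm (Z a \<phi> x))\<^sup>2) \<le> v"
  shows "integrable M (\<lambda>\<omega>. (norm (\<Sum>a\<in>B. Z a (X \<omega>) (\<xi> a \<omega>)))\<^sup>2)"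
    and "(LINT \<omega>|M. (norm (\<Sum>a\<in>B. Z a (X \<omega>) (\<xi> a \<omega>)))\<^sup>2) \<le> real (card B) * v"
    and "(LINT \<omega>|M. U \<omega> \<bullet> (\<Sum>a\<in>B. Z a (X \<omega>) (\<xi> a \<omega>))) = 0"
proof -
  define W where "W a \<omega> = Z a (X \<omega>) (\<xi> a \<omega>)" for a \<omega>
  have rv: "\<xi> a \<in> M \<rightarrow>\<^sub>M N a" if "a \<in> I" for a
    using indep that by (auto simp: indep_vars_def)
  have W_hist: "W a \<in> borel_measurable (gen_sigma M N \<xi> (insert a J))" if a: "a \<in> B" for a
  proof -
    have "X \<in> borel_measurable (gen_sigma M N \<xi> (insert a J))"
      by (rule measurable_gen_sigma_mono[OF X]) auto
    moreover have "\<xi> a \<in> gen_sigma M N \<xi> (insert a J) \<rightarrow>\<^sub>M N a"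
      using rv a B by (intro measurable_gen_sigma) auto
    ultimately have "(\<lambda>\<omega>. (X \<omega>, \<xi> a \<omega>)) \<in> gen_sigma M N \<xi> (insert a J) \<rightarrow>\<^sub>M borel \<Otimes>\<^sub>M N a"
      by (rule measurable_Pair)
    from measurable_compose[OF this Z[OF a]] show ?thesis by (simp add: W_def[abs_def])
  qed
  have W: "W a \<in> borel_measurable M" if "a \<in> B" for a
    using that B J rv by (intro measurable_gen_sigma_imp_measurable[OF W_hist]) auto
  have UM: "U \<in> borel_measurable M"
    using J rv by (intro measurable_gen_sigma_imp_measurable[OF U(1)]) auto
  have W2: "integrable M (\<lambda>\<omega>. (norm (W a \<omega>))\<^sup>2)" "(LINT \<omega>|M. (norm (W a \<omega>))\<^sup>2) \<le> v" if a: "a \<in> B" for a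
  proof -
    have "indep_pair borel X (N a) (\<xi> a)"
      using indep_pair_gen_sigma[OF indep J _ X, of a] a B by auto
    from noise_second_moment[OF this law[OF a] Z[OF a] int2[OF a] var[OF a]]
    show "integrable M (\<lambda>\<omega>. (norm (W a \<omega>))\<^sup>2)" "(LINT \<omega>|M. (norm (W a \<omega>))\<^sup>2) \<le> v"
      by (simp_all add: W_def)
  qed
  have orth: "(LINT \<omega>|M. Q \<omega> \<bullet> W a \<omega>) = 0"
    if a: "a \<in> B" and J': "J \<subseteq> J'" "J' \<subseteq> I" "a \<notin> J'"
      and Q: "Q \<in> borel_measurable (gen_sigma M N \<xi> J')" "integrable M (\<lambda>\<omega>. (norm (Q \<omega>))\<^sup>2)" for a J' Q
  proof -
    have "(\<lambda>\<omega>. (X \<omega>, Q \<omega>)) \<in> gen_sigma M N \<xi> J' \<rightarrow>\<^sub>M borel \<Otimes>\<^sub>M borel"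
      using measurable_gen_sigma_mono[OF X J'(1)] Q(1) by (rule measurable_Pair)
    then have "indep_pair (borel \<Otimes>\<^sub>M borel) (\<lambda>\<omega>. (X \<omega>, Q \<omega>)) (N a) (\<xi> a)"
      using J' a B by (intro indep_pair_gen_sigma[OF indep]) auto
    from noise_orthogonal[OF this law[OF a] Z[OF a] int[OF a] mean[OF a] Q(2)] W2(1)[OF a]
    show ?thesis by (simp add: W_def)
  qed
  \<comment> \<open>The noise of sample \<open>a\<close> counts as part of the past of sample
    \<open>c\<close>: it is measurable for \<open>insert a J\<close>, which does not contain
    \<open>c\<close>.\<close>
  have pair: "(LINT \<omega>|M. W a \<omega> \<bullet> W c \<omega>) = 0" if "a \<in> B" "c \<in> B" "a \<noteq> c" for a c
    using that B J by (intro orth[of c "insert a J"] W_hist W2) auto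
  have sum2: "integrable M (\<lambda>\<omega>. (norm (\<Sum>a\<in>B. W a \<omega>))\<^sup>2)"
    and sum_eq: "(LINT \<omega>|M. (norm (\<Sum>a\<in>B. W a \<omega>))\<^sup>2) = (\<Sum>a\<in>B. LINT \<omega>|M. (norm (W a \<omega>))\<^sup>2)"
    by (rule integral_norm_square_orthogonal_sum; use B(2) W W2(1) pair in blast)+
  from sum2 show "integrable M (\<lambda>\<omega>. (norm (\<Sum>a\<in>B. Z a (X \<omega>) (\<xi> a \<omega>)))\<^sup>2)"
    by (simp add: W_def)
  have "(LINT \<omega>|M. (norm (\<Sum>a\<in>B. W a \<omega>))\<^sup>2) \<le> (\<Sum>a\<in>B. v)"
    unfolding sum_eq by (rule sum_mono) (rule W2(2))
  then show "(LINT \<omega>|M. (norm (\<Sum>a\<in>B. Z a (X \<omega>) (\<xi> a \<omega>)))\<^sup>2) \<le> real (card B) * v"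
    by (simp add: W_def)
  have "(LINT \<omega>|M. U \<omega> \<bullet> (\<Sum>a\<in>B. W a \<omega>)) = (\<Sum>a\<in>B. LINT \<omega>|M. U \<omega> \<bullet> W a \<omega>)"
    unfolding inner_sum_right
    by (intro Bochner_Integration.integral_sum integrable_inner_of_square_integrable U(2) W2 W UM)
  also have "\<dots> = 0"
    using B J U by (intro sum.neutral ballI orth[of _ J]) auto
  finally show "(LINT \<omega>|M. U \<omega> \<bullet> (\<Sum>a\<in>B. Z a (X \<omega>) (\<xi> a \<omega>))) = 0"
    by (simp add: W_def)
qed

end

section \<open>Expected descent\<close>

text \<open>Comparison with the value at 0 gives linear growth, and the constant \<open>G 0\<close>
  is square-integrable over a finite measure.\<close>

lemma square_integrable_lipschitz:
  fixes G :: "'v::euclidean_space \<Rightarrow> 'v"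
  assumes M: "finite_measure M" and lip: "\<And>\<phi> \<psi>. norm (G \<phi> - G \<psi>) \<le> L * norm (\<phi> - \<psi>)"
    and X[measurable]: "X \<in> borel_measurable M" and G[measurable]: "G \<in> borel_measurable borel"
    and X2: "integrable M (\<lambda>\<omega>. (norm (X \<omega>))\<^sup>2)"
  shows "integrable M (\<lambda>\<omega>. (norm (G (X \<omega>)))\<^sup>2)"
proof -
  interpret finite_measure M by fact
  have "integrable M (\<lambda>\<omega>. (norm (G (X \<omega>) - G 0))\<^sup>2)"
  proof (rule Bochner_Integration.integrable_bound)
    show "integrable M (\<lambda>\<omega>. L\<^sup>2 * (norm (X \<omega>))\<^sup>2)" using X2 by simp
    have "(norm (G x - G 0))\<^sup>2 \<le> L\<^sup>2 * (norm x)\<^sup>2" for x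
      using power_mono[OF lip[of x 0], of 2] by (simp add: power_mult_distrib)
    then show "AE \<omega> in M. norm ((norm (G (X \<omega>) - G 0))\<^sup>2) \<le> norm (L\<^sup>2 * (norm (X \<omega>))\<^sup>2)"
      by simp
  qed measurable
  from square_integrable_add[OF _ _ this, of "\<lambda>_. G 0"] show ?thesis by simp
qed

text \<open>Smoothness expanded at the base point 0 bounds \<open>F\<close> above by a quadratic,
  and \<open>c\<close> bounds it below.\<close>

lemma integrable_smooth_bounded_below:
  fixes F :: "'v::euclidean_space \<Rightarrow> real"
  assumes M: "finite_measure M"
    and smooth: "\<And>\<phi> \<psi>. F \<psi> \<le> F \<phi> + G \<phi> \<bullet> (\<psi> - \<phi>) + L / 2 * (norm (\<psi> - \<phi>))\<^sup>2"
    and lower: "\<And>\<phi>. c \<le> F \<phi>" and "L \<ge> 0"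
    and X[measurable]: "X \<in> borel_measurable M" and F[measurable]: "F \<in> borel_measurable borel"
    and X2: "integrable M (\<lambda>\<omega>. (norm (X \<omega>))\<^sup>2)"
  shows "integrable M (\<lambda>\<omega>. F (X \<omega>))"
proof (rule Bochner_Integration.integrable_bound)
  interpret finite_measure M by fact
  let ?h = "\<lambda>x. \<bar>c\<bar> + \<bar>F 0\<bar> + (norm (G 0))\<^sup>2 + (1 + L / 2) * (norm x)\<^sup>2"
  show "integrable M (\<lambda>\<omega>. ?h (X \<omega>))"
    using X2 by simp
  have "norm (F x) \<le> ?h x" for x
  proof -
    have "G 0 \<bullet> x \<le> (norm (G 0))\<^sup>2 + (norm x)\<^sup>2"
    proof -
      have "2 * (norm (G 0) * norm x) \<le> (norm (G 0))\<^sup>2 + (norm x)\<^sup>2" "0 \<le> norm (G 0) * norm x"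
        using sum_squares_bound[of "norm (G 0)" "norm x"] by (simp_all add: mult.assoc)
      then show ?thesis using norm_cauchy_schwarz[of "G 0" x] by linarith
    qed
    then have "F x \<le> F 0 + (norm (G 0))\<^sup>2 + (1 + L / 2) * (norm x)\<^sup>2"
      using smooth[of x 0] by (simp add: algebra_simps)
    moreover have "0 \<le> (norm (G 0))\<^sup>2" "0 \<le> (1 + L / 2) * (norm x)\<^sup>2"
      using \<open>L \<ge> 0\<close> by auto
    ultimately show ?thesis
      using lower[of x] unfolding real_norm_def by linarith
  qed
  then show "AE \<omega> in M. norm (F (X \<omega>)) \<le> norm (?h (X \<omega>))"
    by (intro AE_I2) (smt (verit) real_norm_def)
qed measurable

text \<open>Balance of the constants: the squared gradient, in units of \<open>\<eta>\<close>, gets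
  -1 + 3/8 + 1/8 = -1/2, and \<open>K\<^sup>2 * \<eta> ^ 3\<close> gets 2/3 + 1/8 = 19/24. The
  product \<open>g \<bullet> V\<close> is kept exact instead of being estimated, because its mean
  will vanish.\<close>

lemma perturbed_gradient_step:
  fixes F :: "'v::euclidean_space \<Rightarrow> real"
  assumes smooth: "F \<psi> \<le> F \<phi> + g \<bullet> (\<psi> - \<phi>) + L / 2 * (norm (\<psi> - \<phi>))\<^sup>2"
    and \<psi>: "\<psi> = \<phi> - \<eta> *\<^sub>R (g + V) + e" and e: "norm e \<le> K * \<eta>\<^sup>2"
    and "0 < L" "0 < \<eta>" "\<eta> \<le> 1 / (8 * L)"
  shows "F \<psi> \<le> F \<phi> - \<eta> / 2 * (norm g)\<^sup>2 + (2 * L * \<eta>\<^sup>2 - \<eta>) * (g \<bullet> V) + L * \<eta>\<^sup>2 * (norm V)\<^sup>2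
    + 19 / 24 * K\<^sup>2 * \<eta> ^ 3"
proof -
  have L\<eta>: "L * \<eta> \<le> 1 / 8"
    using assms(4-6) by (simp add: field_simps)
  have e2: "(norm e)\<^sup>2 \<le> K\<^sup>2 * \<eta> ^ 4"
    using power_mono[OF e, of 2] by (simp add: power_mult_distrib flip: power_mult)
  \<comment> \<open>Young's inequality as a completed square: 9/24 = 3/8, 16/24 = 2/3, and the cross
    term is exactly \<open>norm g * norm e\<close>.\<close>
  have "0 \<le> (3 * \<eta> * norm g - 4 * norm e)\<^sup>2 / (24 * \<eta>)"
    using \<open>0 < \<eta>\<close> by simp
  also have "\<dots> = 3 / 8 * \<eta> * (norm g)\<^sup>2 + 2 / (3 * \<eta>) * (norm e)\<^sup>2 - norm g * norm e"
    using \<open>0 < \<eta>\<close> by (simp add: power2_eq_square field_simps)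
  finally have "g \<bullet> e \<le> 3 / 8 * \<eta> * (norm g)\<^sup>2 + 2 / (3 * \<eta>) * (norm e)\<^sup>2"
    using norm_cauchy_schwarz[of g e] by linarith
  also have "2 / (3 * \<eta>) * (norm e)\<^sup>2 \<le> 2 / (3 * \<eta>) * (K\<^sup>2 * \<eta> ^ 4)"
    using e2 \<open>0 < \<eta>\<close> by (intro mult_left_mono) auto
  also have "2 / (3 * \<eta>) * (K\<^sup>2 * \<eta> ^ 4) = 2 / 3 * (K\<^sup>2 * \<eta> ^ 3)"
    using \<open>0 < \<eta>\<close> by (simp add: field_simps eval_nat_numeral)
  finally have ge: "g \<bullet> e \<le> 3 / 8 * \<eta> * (norm g)\<^sup>2 + 2 / 3 * (K\<^sup>2 * \<eta> ^ 3)" by simp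
  have "(norm (\<psi> - \<phi>))\<^sup>2 \<le> 2 * (norm (- \<eta> *\<^sub>R (g + V)))\<^sup>2 + 2 * (norm e)\<^sup>2"
    using norm_add_square_le[of "- \<eta> *\<^sub>R (g + V)" e] by (simp add: \<psi>)
  also have "\<dots> = 2 * \<eta>\<^sup>2 * ((norm g)\<^sup>2 + 2 * (g \<bullet> V) + (norm V)\<^sup>2) + 2 * (norm e)\<^sup>2"
    by (simp add: power_mult_distrib power2_norm_eq_inner inner_add_left inner_add_right inner_commute
        power2_eq_square[of \<eta>] algebra_simps)
  finally have "L / 2 * (norm (\<psi> - \<phi>))\<^sup>2
      \<le> L / 2 * (2 * \<eta>\<^sup>2 * ((norm g)\<^sup>2 + 2 * (g \<bullet> V) + (norm V)\<^sup>2) + 2 * (norm e)\<^sup>2)"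
    using \<open>0 < L\<close> by (intro mult_left_mono) auto
  also have "\<dots> = (L * \<eta>) * (\<eta> * (norm g)\<^sup>2) + 2 * L * \<eta>\<^sup>2 * (g \<bullet> V) + L * \<eta>\<^sup>2 * (norm V)\<^sup>2
      + L * (norm e)\<^sup>2"
    by (simp add: power2_eq_square algebra_simps)
  also have "(L * \<eta>) * (\<eta> * (norm g)\<^sup>2) \<le> 1 / 8 * (\<eta> * (norm g)\<^sup>2)"
    using L\<eta> \<open>0 < \<eta>\<close> by (intro mult_right_mono) auto
  also have "L * (norm e)\<^sup>2 \<le> L * (K\<^sup>2 * \<eta> ^ 4)"
    using e2 \<open>0 < L\<close> by (intro mult_left_mono) auto
  also have "L * (K\<^sup>2 * \<eta> ^ 4) = (L * \<eta>) * (K\<^sup>2 * \<eta> ^ 3)"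
    by (simp add: eval_nat_numeral)
  also have "(L * \<eta>) * (K\<^sup>2 * \<eta> ^ 3) \<le> 1 / 8 * (K\<^sup>2 * \<eta> ^ 3)"
    using L\<eta> \<open>0 < \<eta>\<close> by (intro mult_right_mono) auto
  finally have sq: "L / 2 * (norm (\<psi> - \<phi>))\<^sup>2 \<le> 1 / 8 * (\<eta> * (norm g)\<^sup>2) + 2 * L * \<eta>\<^sup>2 * (g \<bullet> V)
      + L * \<eta>\<^sup>2 * (norm V)\<^sup>2 + 1 / 8 * (K\<^sup>2 * \<eta> ^ 3)" by simp
  have "g \<bullet> (\<psi> - \<phi>) = - \<eta> * (norm g)\<^sup>2 - \<eta> * (g \<bullet> V) + g \<bullet> e"
    by (simp add: \<psi> inner_add_right inner_diff_right power2_norm_eq_inner algebra_simps)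
  with smooth ge sq show ?thesis
    by (simp add: algebra_simps)
qed

text \<open>Square-integrability of the new model is concluded along with the descent, since it is a
  hypothesis on the old one; this makes the lemma iterable over the rounds.\<close>

lemma (in prob_space) expected_descent:
  fixes F :: "'v::euclidean_space \<Rightarrow> real"
  assumes lip: "\<And>\<phi> \<psi>. norm (G \<phi> - G \<psi>) \<le> L * norm (\<phi> - \<psi>)"
    and smooth: "\<And>\<phi> \<psi>. F \<psi> \<le> F \<phi> + G \<phi> \<bullet> (\<psi> - \<phi>) + L / 2 * (norm (\<psi> - \<phi>))\<^sup>2"
    and lower: "\<And>\<phi>. c \<le> F \<phi>"
    and F[measurable]: "F \<in> borel_measurable borel" and G[measurable]: "G \<in> borel_measurable borel"
    and L: "0 < L" and \<eta>: "0 < \<eta>" "\<eta> \<le> 1 / (8 * L)"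
    and [measurable]: "X \<in> borel_measurable M" "X' \<in> borel_measurable M" "V \<in> borel_measurable M"
    and X2: "integrable M (\<lambda>\<omega>. (norm (X \<omega>))\<^sup>2)" and V2: "integrable M (\<lambda>\<omega>. (norm (V \<omega>))\<^sup>2)"
    and orth: "(LINT \<omega>|M. G (X \<omega>) \<bullet> V \<omega>) = 0" and var: "(LINT \<omega>|M. (norm (V \<omega>))\<^sup>2) \<le> v"
    and err: "AE \<omega> in M. norm (X' \<omega> - (X \<omega> - \<eta> *\<^sub>R (G (X \<omega>) + V \<omega>))) \<le> K * \<eta>\<^sup>2"
  shows "integrable M (\<lambda>\<omega>. (norm (X' \<omega>))\<^sup>2)"
    and "(LINT \<omega>|M. F (X' \<omega>)) \<le> (LINT \<omega>|M. F (X \<omega>)) - \<eta> / 2 * (LINT \<omega>|M. (norm (G (X \<omega>)))\<^sup>2)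
      + L * \<eta>\<^sup>2 * v + 19 / 24 * K\<^sup>2 * \<eta> ^ 3"
proof -
  define e where "e \<omega> = X' \<omega> - (X \<omega> - \<eta> *\<^sub>R (G (X \<omega>) + V \<omega>))" for \<omega>
  have [measurable]: "e \<in> borel_measurable M" unfolding e_def[abs_def] by measurable
  have G2: "integrable M (\<lambda>\<omega>. (norm (G (X \<omega>)))\<^sup>2)"
    by (rule square_integrable_lipschitz[OF _ lip _ _ X2]) (unfold_locales, measurable)
  have e2: "integrable M (\<lambda>\<omega>. (norm (e \<omega>))\<^sup>2)"
  proof (rule integrable_const_bound)
    show "AE \<omega> in M. norm ((norm (e \<omega>))\<^sup>2) \<le> (K * \<eta>\<^sup>2)\<^sup>2"
      using err by eventually_elim (simp add: e_def power_mono)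
  qed measurable
  have "integrable M (\<lambda>\<omega>. (norm (X \<omega> + (- \<eta>) *\<^sub>R (G (X \<omega>) + V \<omega>)))\<^sup>2)"
    by (intro square_integrable_add square_integrable_scaleR X2 G2 V2) measurable
  \<comment> \<open>By definition of \<open>e\<close> this sum is \<open>X'\<close>: a noisy
    gradient step plus an almost surely bounded perturbation.\<close>
  from this e2 have "integrable M (\<lambda>\<omega>. (norm (X \<omega> + (- \<eta>) *\<^sub>R (G (X \<omega>) + V \<omega>) + e \<omega>))\<^sup>2)"
    by (rule square_integrable_add[rotated 2]) measurable
  then show X'2: "integrable M (\<lambda>\<omega>. (norm (X' \<omega>))\<^sup>2)"
    by (simp add: e_def)
  have FX: "integrable M (\<lambda>\<omega>. F (X \<omega>))" and FX': "integrable M (\<lambda>\<omega>. F (X' \<omega>))"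
    using L by (auto intro!: integrable_smooth_bounded_below[OF _ smooth lower] X2 X'2 finite_measure_axioms)
  have GV: "integrable M (\<lambda>\<omega>. G (X \<omega>) \<bullet> V \<omega>)"
    by (intro integrable_inner_of_square_integrable G2 V2) measurable
  have "(LINT \<omega>|M. F (X' \<omega>)) \<le> (LINT \<omega>|M. F (X \<omega>) - \<eta> / 2 * (norm (G (X \<omega>)))\<^sup>2
      + (2 * L * \<eta>\<^sup>2 - \<eta>) * (G (X \<omega>) \<bullet> V \<omega>) + L * \<eta>\<^sup>2 * (norm (V \<omega>))\<^sup>2 + 19 / 24 * K\<^sup>2 * \<eta> ^ 3)"
  proof (rule integral_mono_AE)
    show "AE \<omega> in M. F (X' \<omega>) \<le> F (X \<omega>) - \<eta> / 2 * (norm (G (X \<omega>)))\<^sup>2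
      + (2 * L * \<eta>\<^sup>2 - \<eta>) * (G (X \<omega>) \<bullet> V \<omega>) + L * \<eta>\<^sup>2 * (norm (V \<omega>))\<^sup>2 + 19 / 24 * K\<^sup>2 * \<eta> ^ 3"
      using err
    proof eventually_elim
      case (elim \<omega>)
      show ?case
        by (rule perturbed_gradient_step[OF smooth _ elim L \<eta>]) simp
    qed
  qed (use FX FX' GV G2 V2 in simp_all)
  also have "\<dots> = (LINT \<omega>|M. F (X \<omega>)) - \<eta> / 2 * (LINT \<omega>|M. (norm (G (X \<omega>)))\<^sup>2)
      + (2 * L * \<eta>\<^sup>2 - \<eta>) * (LINT \<omega>|M. G (X \<omega>) \<bullet> V \<omega>) + L * \<eta>\<^sup>2 * (LINT \<omega>|M. (norm (V \<omega>))\<^sup>2)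
      + 19 / 24 * K\<^sup>2 * \<eta> ^ 3"
    using FX GV G2 V2 by (simp add: prob_space)
  also have "\<dots> \<le> (LINT \<omega>|M. F (X \<omega>)) - \<eta> / 2 * (LINT \<omega>|M. (norm (G (X \<omega>)))\<^sup>2)
      + L * \<eta>\<^sup>2 * v + 19 / 24 * K\<^sup>2 * \<eta> ^ 3"
    using mult_left_mono[OF var, of "L * \<eta>\<^sup>2"] L by (simp add: orth)
  finally show "(LINT \<omega>|M. F (X' \<omega>)) \<le> (LINT \<omega>|M. F (X \<omega>)) - \<eta> / 2 * (LINT \<omega>|M. (norm (G (X \<omega>)))\<^sup>2)
      + L * \<eta>\<^sup>2 * v + 19 / 24 * K\<^sup>2 * \<eta> ^ 3" .
qed

section \<open>Convergence of AdaBFL\<close>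

lemma borel_measurable_sample_grad:
  fixes f :: "nat \<Rightarrow> real^'d \<Rightarrow> 'x \<Rightarrow> real"
  assumes "\<And>\<phi> x. x \<in> space (D i) \<Longrightarrow> (\<lambda>\<phi>'. f i \<phi>' x) differentiable (at \<phi>)"
    and "\<And>\<phi>. f i \<phi> \<in> borel_measurable (D i)"
  shows "(\<lambda>p. sample_grad f i (fst p) (snd p)) \<in> borel_measurable (borel \<Otimes>\<^sub>M D i)"
  using borel_measurable_grad_joint[of "D i" "f i"] assms by (simp add: sample_grad_def)

text \<open>Model and weights go through one induction because the weights are carried from round to
  round and enter the next model.\<close>

lemma adabfl_run_adapted:
  fixes f :: "nat \<Rightarrow> real^'d \<Rightarrow> 'x \<Rightarrow> real" and M :: "'w measure"
  assumes clients: "participants P \<le> N"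
    and diff: "\<And>i x \<phi>. i \<in> {1..N} \<Longrightarrow> x \<in> space (D i) \<Longrightarrow> (\<lambda>\<phi>'. f i \<phi>' x) differentiable (at \<phi>)"
    and f: "\<And>i \<phi>. i \<in> {1..N} \<Longrightarrow> f i \<phi> \<in> borel_measurable (D i)"
    and \<xi>: "\<And>t i j. t < T \<Longrightarrow> i \<in> {1..N} \<Longrightarrow> j \<in> {1..b} \<Longrightarrow> \<xi> t i j \<in> M \<rightarrow>\<^sub>M D i"
    and s: "\<And>t. t \<in> {1..T} \<Longrightarrow> s t \<in> sample_history M D N b \<xi> t \<rightarrow>\<^sub>M count_space UNIV"
    and run: "\<And>\<omega>. \<omega> \<in> space M \<Longrightarrow>
      adabfl_run P f b \<eta> T \<theta>\<^sub>0 (\<lambda>t i j. \<xi> t i j \<omega>) (\<lambda>t. s t \<omega>) (\<lambda>t. w t \<omega>) (\<lambda>t. \<theta> t \<omega>)"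
    and "t \<le> T"
  shows "\<theta> t \<in> borel_measurable (sample_history M D N b \<xi> t)"
    and "w t \<in> borel_measurable (sample_history M D N b \<xi> t)"
proof -
  let ?H = "sample_history M D N b \<xi>"
  have space_H: "space (?H t) = space M" for t
    by (simp add: sample_history_eq_gen_sigma)
  have "\<theta> t \<in> borel_measurable (?H t) \<and> w t \<in> borel_measurable (?H t)"
    using \<open>t \<le> T\<close>
  proof (induction t)
    case 0
    have "\<theta> 0 \<omega> = \<theta>\<^sub>0" "w 0 \<omega> = init_weights P" if "\<omega> \<in> space (?H 0)" for \<omega>
      using run[of \<omega>] that by (auto simp: adabfl_run_def space_H)
    then show ?case by (simp cong: measurable_cong)
  next
    case (Suc t)
    then have t: "t < T" and IH: "\<theta> t \<in> borel_measurable (?H t)" "w t \<in> borel_measurable (?H t)"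
      by auto
    have mono: "g \<in> borel_measurable (?H (Suc t))"
      if "g \<in> borel_measurable (?H t)" for g :: "'w \<Rightarrow> 'b::topological_space"
      using that unfolding sample_history_eq_gen_sigma by (rule measurable_gen_sigma_mono) auto
    \<comment> \<open>Round \<open>Suc t\<close> reads the samples of index \<open>t\<close>, which
      belong to the history at \<open>Suc t\<close> but are not among the generators of the history
      at \<open>t\<close>.\<close>
    define \<phi> where "\<phi> i \<omega> = \<theta> t \<omega> - \<eta> *\<^sub>R batch_grad f b (\<lambda>t i j. \<xi> t i j \<omega>) (\<lambda>t. \<theta> t \<omega>) (Suc t) i" for i \<omega>
    have "(\<lambda>\<omega>. sample_grad f i (\<theta> t \<omega>) (\<xi> t i j \<omega>)) \<in> borel_measurable (?H (Suc t))"
      if ij: "i \<in> {1..N}" "j \<in> {1..b}" for i j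
    proof -
      have "\<xi> t i j \<in> ?H (Suc t) \<rightarrow>\<^sub>M D i"
        using measurable_gen_sigma[of "(t, i, j)" "{..<Suc t} \<times> {1..N} \<times> {1..b}" "\<lambda>(t, i, j). \<xi> t i j" M
            "\<lambda>(t, i, j). D i"] \<xi>[OF t ij] ij
        by (simp add: sample_history_eq_gen_sigma)
      from measurable_compose[OF measurable_Pair[OF mono[OF IH(1)] this] borel_measurable_sample_grad[of D i f]]
      show ?thesis using diff f ij by simp
    qed
    then have "\<phi> i \<in> borel_measurable (?H (Suc t))" if "i \<in> {1..participants P}" for i
      using that clients mono[OF IH(1)] unfolding \<phi>_def[abs_def] batch_grad_def
      by (intro borel_measurable_diff borel_measurable_scaleR borel_measurable_sum borel_measurable_const) auto
    moreover have "s (Suc t) \<in> ?H (Suc t) \<rightarrow>\<^sub>M count_space UNIV"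
      using s[of "Suc t"] t by simp
    moreover have "adabfl_step P (Suc t) (\<lambda>i. \<phi> i \<omega>) (s (Suc t) \<omega>) (w t \<omega>) (w (Suc t) \<omega>) (\<theta> (Suc t) \<omega>)"
      if "\<omega> \<in> space (?H (Suc t))" for \<omega>
      using run[of \<omega>] that t unfolding adabfl_run_def space_H \<phi>_def by force
    ultimately show ?case
      using adabfl_step_measurable[of P \<phi> "?H (Suc t)" "s (Suc t)" "w t"] mono[OF IH(2)] by blast
  qed
  then show "\<theta> t \<in> borel_measurable (?H t)" "w t \<in> borel_measurable (?H t)" by auto
qed

lemma has_gradient_global_loss:
  assumes "\<And>i. i \<in> {1..N} \<Longrightarrow> local_loss D f i differentiable (at \<phi>)"
  shows "GDERIV (global_loss D f N) \<phi> :> (1 / real N) *\<^sub>R (\<Sum>i\<in>{1..N}. grad (local_loss D f i) \<phi>)"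
proof -
  have "GDERIV (\<lambda>\<phi>. \<Sum>i\<in>{1..N}. local_loss D f i \<phi>) \<phi> :> (\<Sum>i\<in>{1..N}. grad (local_loss D f i) \<phi>)"
    by (intro GDERIV_sum GDERIV_grad assms)
  from GDERIV_mult[OF GDERIV_const[of "1 / real N"] this]
  show ?thesis unfolding global_loss_def[abs_def] by simp
qed

text \<open>The deviations are summed over triples so that the index set is a block of the
  independent family of samples; \<open>g\<close> will be the local gradients at the current
  model.\<close>

lemma mean_batch_grad_decomposition:
  assumes "N \<ge> 1" "b \<ge> 1"
  shows "(1 / real N) *\<^sub>R (\<Sum>i\<in>{1..N}. batch_grad f b \<xi> \<theta> (Suc t) i)
    = (1 / real N) *\<^sub>R (\<Sum>i\<in>{1..N}. g i) + (1 / real (N * b)) *\<^sub>R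
        (\<Sum>(s, i, j)\<in>{t} \<times> {1..N} \<times> {1..b}. sample_grad f i (\<theta> t) (\<xi> s i j) - g i)"
proof -
  have "(\<Sum>(s, i, j)\<in>{t} \<times> {1..N} \<times> {1..b}. sample_grad f i (\<theta> t) (\<xi> s i j) - g i)
      = (\<Sum>i\<in>{1..N}. \<Sum>j\<in>{1..b}. sample_grad f i (\<theta> t) (\<xi> t i j) - g i)"
    by (simp add: sum.cartesian_product[symmetric])
  also have "\<dots> = (\<Sum>i\<in>{1..N}. \<Sum>j\<in>{1..b}. sample_grad f i (\<theta> t) (\<xi> t i j)) - real b *\<^sub>R (\<Sum>i\<in>{1..N}. g i)"
    by (simp add: sum_subtractf scaleR_sum_right sum_constant_scaleR del: sum_constant)
  finally show ?thesis
    using assms by (simp add: batch_grad_def scaleR_diff_right scaleR_sum_right[symmetric])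
qed

theorem theorem1:
  fixes M :: "'w measure" and D :: "nat \<Rightarrow> 'x measure"
    and f :: "nat \<Rightarrow> real^'d \<Rightarrow> 'x \<Rightarrow> real"
    and \<xi> :: "nat \<Rightarrow> nat \<Rightarrow> nat \<Rightarrow> 'w \<Rightarrow> 'x"
    and P :: adabfl_params
    and s :: "nat \<Rightarrow> 'w \<Rightarrow> nat"
    and w :: "nat \<Rightarrow> 'w \<Rightarrow> real \<times> real \<times> real"
    and \<theta> :: "nat \<Rightarrow> 'w \<Rightarrow> real^'d"
    and \<theta>\<^sub>0 :: "real^'d"
    and N b T :: nat and L \<sigma> \<tau> \<eta> K :: real
    and F :: "real^'d \<Rightarrow> real"
  assumes F_eq: "F = global_loss D f N"
    and sizes: "N \<ge> 1" "b \<ge> 1" "T \<ge> 1"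
    and constants: "L > 0" "\<sigma> \<ge> 0" "\<tau> \<ge> 0"
    and clients: "2 \<le> participants P" "participants P \<le> N"
    and params: "gam P > 0" "kap P > 0" "\<And>t. lam P t \<ge> 0" "mono (lam P) \<or> antimono (lam P)"
    \<comment> \<open>data distributions and sample losses\<close>
    and D_prob: "\<And>i. i \<in> {1..N} \<Longrightarrow> prob_space (D i)"
    and f_integrable: "\<And>i \<phi>. i \<in> {1..N} \<Longrightarrow> integrable (D i) (f i \<phi>)"
    and f_differentiable: "\<And>i x \<phi>. i \<in> {1..N} \<Longrightarrow> x \<in> space (D i) \<Longrightarrow>
          (\<lambda>\<phi>'. f i \<phi>' x) differentiable (at \<phi>)"
    and loss_differentiable: "\<And>i \<phi>. i \<in> {1..N} \<Longrightarrow> local_loss D f i differentiable (at \<phi>)"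
    \<comment> \<open>(1) smoothness\<close>
    and smooth_grad: "\<And>\<phi> \<psi>. norm (grad F \<phi> - grad F \<psi>) \<le> L * norm (\<phi> - \<psi>)"
    and smooth_descent: "\<And>\<phi> \<psi>. F \<psi> \<le> F \<phi> + grad F \<phi> \<bullet> (\<psi> - \<phi>) + L / 2 * (norm (\<psi> - \<phi>))\<^sup>2"
    \<comment> \<open>(2) unbiasedness and bounded variance\<close>
    and grad_integrable: "\<And>i \<phi>. i \<in> {1..N} \<Longrightarrow> integrable (D i) (sample_grad f i \<phi>)"
    and unbiased: "\<And>i \<phi>. i \<in> {1..N} \<Longrightarrow>
          (LINT x|D i. sample_grad f i \<phi> x) = grad (local_loss D f i) \<phi>"
    and var_integrable: "\<And>i \<phi>. i \<in> {1..N} \<Longrightarrow>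
          integrable (D i) (\<lambda>x. (norm (sample_grad f i \<phi> x - grad (local_loss D f i) \<phi>))\<^sup>2)"
    and variance: "\<And>i \<phi>. i \<in> {1..N} \<Longrightarrow>
          (LINT x|D i. (norm (sample_grad f i \<phi> x - grad (local_loss D f i) \<phi>))\<^sup>2) \<le> \<sigma>\<^sup>2"
    \<comment> \<open>(3) bounded heterogeneity\<close>
    and heterogeneity: "\<And>i \<phi>. i \<in> {1..N} \<Longrightarrow>
          (norm (grad (local_loss D f i) \<phi> - grad F \<phi>))\<^sup>2 \<le> \<tau>\<^sup>2"
    \<comment> \<open>(4) lower boundedness\<close>
    and bounded_below: "bdd_below (range F)"
    and step_size: "0 < \<eta>" "\<eta> \<le> 1 / (8 * L)"
    \<comment> \<open>sampling\<close>
    and M_prob: "prob_space M"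
    and indep: "prob_space.indep_vars M (\<lambda>(t, i, j). D i) (\<lambda>(t, i, j). \<xi> t i j)
          ({0..<T} \<times> {1..N} \<times> {1..b})"
    and sample_law: "\<And>t i j. t \<in> {0..<T} \<Longrightarrow> i \<in> {1..N} \<Longrightarrow> j \<in> {1..b} \<Longrightarrow> distr M (D i) (\<xi> t i j) = D i"
    \<comment> \<open>the algorithm; ties in the arg max are broken on the basis of the samples drawn so far\<close>
    and adapted: "\<And>t. t \<in> {1..T} \<Longrightarrow> s t \<in> sample_history M D N b \<xi> t \<rightarrow>\<^sub>M count_space UNIV"
    and run: "\<And>\<omega>. \<omega> \<in> space M \<Longrightarrow>
          adabfl_run P f b \<eta> T \<theta>\<^sub>0 (\<lambda>t i j. \<xi> t i j \<omega>) (\<lambda>t. s t \<omega>) (\<lambda>t. w t \<omega>) (\<lambda>t. \<theta> t \<omega>)"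
    and K_eq: "K = sqrt (\<sigma> + \<tau>)"
    and error: "\<And>t. t \<in> {1..T} \<Longrightarrow>
          AE \<omega> in M. norm (agg_error f N b \<eta> (\<lambda>t i j. \<xi> t i j \<omega>) (\<lambda>t. \<theta> t \<omega>) t) \<le> K * \<eta>\<^sup>2"
  shows "(\<forall>t<T. integrable M (\<lambda>\<omega>. (norm (grad F (\<theta> t \<omega>)))\<^sup>2)) \<and>
         (1 / real T) * (\<Sum>t = 0..T - 1. LINT \<omega>|M. (norm (grad F (\<theta> t \<omega>)))\<^sup>2)
           \<le> 2 * (F \<theta>\<^sub>0 - (INF \<phi>. F \<phi>)) / (\<eta> * T) + 7 * K\<^sup>2 * \<eta>\<^sup>2 / 4
             + 2 * L * \<eta> * (2 * \<sigma>\<^sup>2 / (b * N) + \<tau>\<^sup>2)"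
proof -
  interpret prob_space M by (rule M_prob)
  define N' where "N' = (\<lambda>(t::nat, i, j::nat). D i)"
  define X where "X = (\<lambda>(t, i, j). \<xi> t i j)"
  define I where "I = {0..<T} \<times> {1..N} \<times> {1..b}"
  define G where "G = grad F"
  define Z where "Z = (\<lambda>(t::nat, i, j::nat) \<phi> x. sample_grad f i \<phi> x - grad (local_loss D f i) \<phi>)"
  define B where "B t = {t} \<times> {1..N} \<times> {1..b}" for t :: nat
  define V where "V t \<omega> = (1 / real (N * b)) *\<^sub>R (\<Sum>a\<in>B t. Z a (\<theta> t \<omega>) (X a \<omega>))" for t \<omega>
  define v where "v = \<sigma>\<^sup>2 / (real b * real N)"
  define Finf where "Finf = (INF \<phi>. F \<phi>)"
  have lower: "Finf \<le> F \<phi>" for \<phi>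
    unfolding Finf_def using bounded_below by (intro cINF_lower) auto
  have indep': "indep_vars N' X I"
    using indep by (simp add: N'_def X_def I_def)
  have \<xi>_rv: "\<xi> t i j \<in> M \<rightarrow>\<^sub>M D i" if "t < T" "i \<in> {1..N}" "j \<in> {1..b}" for t i j
    using indep that unfolding indep_vars_def by force
  have f_meas: "f i \<phi> \<in> borel_measurable (D i)" if "i \<in> {1..N}" for i \<phi>
    using f_integrable[OF that] by (rule borel_measurable_integrable)
  have hist: "sample_history M D N b \<xi> t = gen_sigma M N' X ({..<t} \<times> {1..N} \<times> {1..b})" for t
    by (simp add: sample_history_eq_gen_sigma N'_def X_def)
  have \<theta>_hist: "\<theta> t \<in> borel_measurable (gen_sigma M N' X ({..<t} \<times> {1..N} \<times> {1..b}))" if "t \<le> T" for t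
    unfolding hist[symmetric]
    by (rule adabfl_run_adapted[OF clients(2) f_differentiable f_meas \<xi>_rv adapted run that])
  have X_rv: "X a \<in> M \<rightarrow>\<^sub>M N' a" if "a \<in> I" for a
    using \<xi>_rv that by (auto simp: X_def N'_def I_def)
  have \<theta>_meas: "\<theta> t \<in> borel_measurable M" if "t \<le> T" for t
    by (rule measurable_gen_sigma_imp_measurable[OF \<theta>_hist[OF that]])
       (use X_rv that in \<open>auto simp: I_def\<close>)
  \<comment> \<open>Identifying the gradient of \<open>F\<close> with the average of the local
    gradients is what makes the mean batch gradient equal to that gradient plus the centred noise
    \<open>V\<close>.\<close>
  have F_grad: "GDERIV F \<phi> :> (1 / real N) *\<^sub>R (\<Sum>i\<in>{1..N}. grad (local_loss D f i) \<phi>)" for \<phi>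
    unfolding F_eq by (intro has_gradient_global_loss loss_differentiable)
  have G_eq: "G \<phi> = (1 / real N) *\<^sub>R (\<Sum>i\<in>{1..N}. grad (local_loss D f i) \<phi>)" for \<phi>
    unfolding G_def by (rule grad_eqI[OF F_grad])
  have "continuous_on UNIV F"
    using has_derivative_continuous[OF F_grad[unfolded gderiv_def]]
    by (simp add: continuous_on_eq_continuous_at)
  then have F_meas[measurable]: "F \<in> borel_measurable borel"
    by (rule borel_measurable_continuous_onI)
  have "L-lipschitz_on UNIV G"
    using smooth_grad constants by (intro lipschitz_onI) (auto simp: G_def dist_norm)
  then have G_meas[measurable]: "G \<in> borel_measurable borel"
    by (intro borel_measurable_continuous_onI lipschitz_on_continuous_on)
  have Z_meas: "(\<lambda>p. Z a (fst p) (snd p)) \<in> borel_measurable (borel \<Otimes>\<^sub>M N' a)" if "a \<in> B t" for a t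
  proof -
    obtain i j where a: "a = (t, i, j)" and i: "i \<in> {1..N}"
      using \<open>a \<in> B t\<close> by (auto simp: B_def)
    have "(\<lambda>p. sample_grad f i (fst p) (snd p)) \<in> borel_measurable (borel \<Otimes>\<^sub>M D i)"
      using f_differentiable f_meas i by (intro borel_measurable_sample_grad) auto
    \<comment> \<open>Only the gradient of \<open>F\<close> is known to be Lipschitz; a local
      gradient may be discontinuous. It is measurable as a limit of difference quotients, with an
      integrand constant in the sample.\<close>
    moreover have "(\<lambda>p. grad (local_loss D f i) (fst p)) \<in> borel_measurable (borel \<Otimes>\<^sub>M D i)"
      using borel_measurable_grad_joint[of "D i" "\<lambda>\<phi> x. local_loss D f i \<phi>"] loss_differentiable[OF i]
      by simp
    ultimately show ?thesis
      unfolding Z_def N'_def a by simp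
  qed
  have batch: "(1 / real N) *\<^sub>R (\<Sum>i\<in>{1..N}. batch_grad f b (\<lambda>t i j. \<xi> t i j \<omega>) (\<lambda>t. \<theta> t \<omega>) (Suc t) i)
      = G (\<theta> t \<omega>) + V t \<omega>" for t \<omega>
  proof -
    have "(\<Sum>a\<in>B t. Z a (\<theta> t \<omega>) (X a \<omega>)) = (\<Sum>(s, i, j)\<in>B t.
        sample_grad f i (\<theta> t \<omega>) (\<xi> s i j \<omega>) - grad (local_loss D f i) (\<theta> t \<omega>))"
      by (rule sum.cong) (auto simp: Z_def X_def)
    then show ?thesis
      unfolding V_def G_eq B_def
      using mean_batch_grad_decomposition[OF sizes(1,2), of f "\<lambda>t i j. \<xi> t i j \<omega>" "\<lambda>t. \<theta> t \<omega>" t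
          "\<lambda>i. grad (local_loss D f i) (\<theta> t \<omega>)"]
      by (simp only:)
  qed
  have step: "integrable M (\<lambda>\<omega>. (norm (\<theta> (Suc t) \<omega>))\<^sup>2) \<and>
      (LINT \<omega>|M. F (\<theta> (Suc t) \<omega>)) \<le> (LINT \<omega>|M. F (\<theta> t \<omega>)) - \<eta> / 2 * (LINT \<omega>|M. (norm (G (\<theta> t \<omega>)))\<^sup>2)
        + L * \<eta>\<^sup>2 * v + 19 / 24 * K\<^sup>2 * \<eta> ^ 3"
    if t: "t < T" and \<theta>2: "integrable M (\<lambda>\<omega>. (norm (\<theta> t \<omega>))\<^sup>2)" for t
  proof -
    let ?J = "{..<t} \<times> {1..N} \<times> {1..b}"
    have sub: "?J \<subseteq> I" "B t \<subseteq> I - ?J" "finite (B t)"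
      using t by (auto simp: I_def B_def)
    have \<theta>t: "\<theta> t \<in> borel_measurable M" and \<theta>Suc: "\<theta> (Suc t) \<in> borel_measurable M"
      using \<theta>_meas t by simp_all
    have V_meas: "V t \<in> borel_measurable M"
    proof -
      have "(\<lambda>\<omega>. Z a (\<theta> t \<omega>) (X a \<omega>)) \<in> borel_measurable M" if "a \<in> B t" for a
        using measurable_compose[OF measurable_Pair[OF \<theta>t X_rv] Z_meas[OF that]]
          that sub by auto
      then show ?thesis unfolding V_def[abs_def]
        by (intro borel_measurable_scaleR borel_measurable_sum borel_measurable_const)
    qed
    have G2: "integrable M (\<lambda>\<omega>. (norm (G (\<theta> t \<omega>)))\<^sup>2)"
      using smooth_grad unfolding G_def[symmetric]
      by (rule square_integrable_lipschitz[OF finite_measure_axioms _ _ G_meas \<theta>2]) (rule \<theta>t)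
    have G_hist: "(\<lambda>\<omega>. G (\<theta> t \<omega>)) \<in> borel_measurable (gen_sigma M N' X ?J)"
      using \<theta>_hist[of t] t by (intro measurable_compose[OF _ G_meas]) simp
    have law: "distr M (N' a) (X a) = N' a" if "a \<in> B t" for a
      using sample_law that t by (auto simp: B_def N'_def X_def)
    have int: "integrable (N' a) (Z a \<phi>)" and mean: "(LINT x|N' a. Z a \<phi> x) = 0"
      and int2: "integrable (N' a) (\<lambda>x. (norm (Z a \<phi> x))\<^sup>2)"
      and var: "(LINT x|N' a. (norm (Z a \<phi> x))\<^sup>2) \<le> \<sigma>\<^sup>2" if "a \<in> B t" for a \<phi>
    proof -
      obtain i j where a: "a = (t, i, j)" and i: "i \<in> {1..N}"
        using \<open>a \<in> B t\<close> by (auto simp: B_def)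
      interpret D: prob_space "D i" by (rule D_prob[OF i])
      show "integrable (N' a) (Z a \<phi>)" "integrable (N' a) (\<lambda>x. (norm (Z a \<phi> x))\<^sup>2)"
        "(LINT x|N' a. (norm (Z a \<phi> x))\<^sup>2) \<le> \<sigma>\<^sup>2" "(LINT x|N' a. Z a \<phi> x) = 0"
        using grad_integrable[OF i] var_integrable[OF i] variance[OF i] unbiased[OF i]
        by (simp_all add: a Z_def N'_def D.prob_space)
    qed
    have \<theta>_hist': "\<theta> t \<in> borel_measurable (gen_sigma M N' X ?J)"
      using \<theta>_hist t by simp
    note noise = minibatch_noise[OF indep' sub law \<theta>_hist' G_hist G2 Z_meas int mean int2 var]
    have V2: "integrable M (\<lambda>\<omega>. (norm (V t \<omega>))\<^sup>2)"
      unfolding V_def by (intro square_integrable_scaleR noise(1))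
    have "(LINT \<omega>|M. (norm (V t \<omega>))\<^sup>2)
        = (1 / real (N * b))\<^sup>2 * (LINT \<omega>|M. (norm (\<Sum>a\<in>B t. Z a (\<theta> t \<omega>) (X a \<omega>)))\<^sup>2)"
      unfolding V_def by (simp add: power_mult_distrib power_divide)
    also have "\<dots> \<le> (1 / real (N * b))\<^sup>2 * (real (card (B t)) * \<sigma>\<^sup>2)"
      by (intro mult_left_mono noise(2)) simp_all
    \<comment> \<open>The block has \<open>N * b\<close> samples, so one of the two factors
      \<open>1 / (N * b)\<close> cancels.\<close>
    also have "\<dots> = v"
      using sizes by (simp add: v_def B_def card_cartesian_product power2_eq_square field_simps)
    finally have var_V: "(LINT \<omega>|M. (norm (V t \<omega>))\<^sup>2) \<le> v" .
    have orth: "(LINT \<omega>|M. G (\<theta> t \<omega>) \<bullet> V t \<omega>) = 0"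
      unfolding V_def by (simp add: noise(3))
    have err: "AE \<omega> in M. norm (\<theta> (Suc t) \<omega> - (\<theta> t \<omega> - \<eta> *\<^sub>R (G (\<theta> t \<omega>) + V t \<omega>))) \<le> K * \<eta>\<^sup>2"
      using error[of "Suc t"] t unfolding agg_error_def batch by simp
    show ?thesis
      using expected_descent[OF smooth_grad[folded G_def] smooth_descent[folded G_def] lower F_meas G_meas
          constants(1) step_size \<theta>t \<theta>Suc V_meas \<theta>2 V2 orth var_V err]
      by blast
  qed
  have \<theta>_0: "\<theta> 0 \<omega> = \<theta>\<^sub>0" if "\<omega> \<in> space M" for \<omega>
    using run[OF that] by (simp add: adabfl_run_def)
  have \<theta>2: "integrable M (\<lambda>\<omega>. (norm (\<theta> t \<omega>))\<^sup>2)" if "t \<le> T" for t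
    using that
  proof (induction t)
    case 0
    show ?case by (simp add: \<theta>_0 cong: Bochner_Integration.integrable_cong)
  qed (simp add: step)
  define c where "c = L * \<eta>\<^sup>2 * v + 19 / 24 * K\<^sup>2 * \<eta> ^ 3"
  define a where "a t = (LINT \<omega>|M. (norm (G (\<theta> t \<omega>)))\<^sup>2)" for t
  \<comment> \<open>Telescoped form of the descent; the deterministic start turns the initial
    expectation into \<open>F \<theta>\<^sub>0\<close>.\<close>
  have "\<eta> / 2 * (\<Sum>t<n. a t) \<le> F \<theta>\<^sub>0 - (LINT \<omega>|M. F (\<theta> n \<omega>)) + n * c" if "n \<le> T" for n
    using that
  proof (induction n)
    case 0
    then show ?case by (simp add: \<theta>_0 prob_space cong: Bochner_Integration.integral_cong)
  next
    case (Suc n)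
    then have "(LINT \<omega>|M. F (\<theta> (Suc n) \<omega>)) \<le> (LINT \<omega>|M. F (\<theta> n \<omega>)) - \<eta> / 2 * a n + c"
      using step[of n] \<theta>2[of n] unfolding c_def a_def by simp
    with Suc show ?case by (simp add: algebra_simps)
  qed
  from this[of T] have "\<eta> / 2 * (\<Sum>t<T. a t) \<le> F \<theta>\<^sub>0 - (LINT \<omega>|M. F (\<theta> T \<omega>)) + T * c" by simp
  moreover have "integrable M (\<lambda>\<omega>. F (\<theta> T \<omega>))"
    using constants by (intro integrable_smooth_bounded_below[OF finite_measure_axioms smooth_descent lower]
        \<theta>_meas \<theta>2 F_meas) auto
  then have "Finf \<le> (LINT \<omega>|M. F (\<theta> T \<omega>))"
    by (intro integral_ge_const) (simp_all add: lower)
  ultimately have "\<eta> / 2 * (\<Sum>t<T. a t) \<le> F \<theta>\<^sub>0 - Finf + T * c" by simp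
  then have "2 / (\<eta> * T) * (\<eta> / 2 * (\<Sum>t<T. a t)) \<le> 2 / (\<eta> * T) * (F \<theta>\<^sub>0 - Finf + T * c)"
    using step_size by (intro mult_left_mono) auto
  also have "2 / (\<eta> * T) * (\<eta> / 2 * (\<Sum>t<T. a t)) = (1 / T) * (\<Sum>t<T. a t)"
    using step_size sizes by (simp add: field_simps)
  also have "2 / (\<eta> * T) * (F \<theta>\<^sub>0 - Finf + T * c) = 2 * (F \<theta>\<^sub>0 - Finf) / (\<eta> * T) + 2 / \<eta> * c"
    using step_size sizes by (simp add: field_simps)
  \<comment> \<open>The two estimates that follow round up to the stated constants: 19/12 is below
    21/12 = 7/4, and \<open>v\<close> is below \<open>2 * v + \<tau>\<^sup>2\<close>.\<close>
  also have "2 / \<eta> * c = 19 * K\<^sup>2 * \<eta>\<^sup>2 / 12 + 2 * L * \<eta> * v"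
    using step_size by (simp add: c_def field_simps power2_eq_square power3_eq_cube)
  also have "19 * K\<^sup>2 * \<eta>\<^sup>2 / 12 \<le> 7 * K\<^sup>2 * \<eta>\<^sup>2 / 4"
    by simp
  also have "2 * L * \<eta> * v \<le> 2 * L * \<eta> * (2 * v + \<tau>\<^sup>2)"
  proof (rule mult_left_mono)
    have "0 \<le> v" by (simp add: v_def)
    then show "v \<le> 2 * v + \<tau>\<^sup>2" using zero_le_power2[of \<tau>] by linarith
  qed (use constants step_size in simp)
  also have "2 * v = 2 * \<sigma>\<^sup>2 / (b * N)" by (simp add: v_def)
  finally have "(1 / T) * (\<Sum>t<T. a t) \<le> 2 * (F \<theta>\<^sub>0 - Finf) / (\<eta> * T) + 7 * K\<^sup>2 * \<eta>\<^sup>2 / 4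
      + 2 * L * \<eta> * (2 * \<sigma>\<^sup>2 / (b * N) + \<tau>\<^sup>2)" by simp
  \<comment> \<open>Relies on \<open>T \<ge> 1\<close>: with truncated subtraction the left side
    would be \<open>{0}\<close> for \<open>T = 0\<close>.\<close>
  moreover have "{0..T - 1} = {..<T}"
    using sizes by auto
  moreover have "integrable M (\<lambda>\<omega>. (norm (G (\<theta> t \<omega>)))\<^sup>2)" if "t < T" for t
    using that smooth_grad[folded G_def]
    by (intro square_integrable_lipschitz[OF finite_measure_axioms _ \<theta>_meas G_meas \<theta>2]) auto
  ultimately show ?thesis
    unfolding a_def G_def Finf_def by simp
qed

end
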